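(* Let $X$ be a finite ordered simplicial complex and $d,n\ge 1$. There is an $\mathfrak S_n$-equivariant deformation retraction of $\Delta^d(X,n)=|Sd(X^n)|-|Sd(\Delta_{d+1}(X,n))|$ onto $W^d(X,n)$, the largest subcomplex of $Sd(X^n)$ not intersecting $|Sd(\Delta_{d+1}(X,n))|$.
   Context: $\Delta_{d+1}(X,n)\subset X^n$ is the set of $(x_1,\ldots,x_n)$ such that $x_{i_0}=\cdots=x_{i_d}$ for some $1\leq i_0<\cdots<i_d\leq n$, and $\Delta^d(X,n)=X^n\setminus\Delta_{d+1}(X,n)$. $\mathfrak S_n$ acts on $X^n$ by permuting coordinates. An ordered simplicial complex is one whose vertices are (partially) ordered so that the vertices of each simplex are totally ordered. For such $X$, the product $X^n$ is given the following simplicial structure: vertices are tuples $(v_1,\ldots,v_n)$ of vertices of $X$, and distinct vertices $w_j=(v_{j1},\ldots,v_{jn})$, $0\leq j\leq q$, span a $q$-simplex if and only if (after suitable ordering of the $w_j$) for each $k=1,\ldots,n$ the vertices $v_{0k},\ldots,v_{qk}$ lie in a common simplex of $X$ and $v_{0k}\leq v_{1k}\leq\cdots\leq v_{qk}$. With this structure $\Delta_{d+1}(X,n)$ is a subcomplex of $X^n$ and $\mathfrak S_n$ acts simplicially. $Sd$ denotes first barycentric subdivision and $|\cdot|$ geometric realization. *)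

theory Defs
  imports "HOL-Analysis.Analysis"
begin

section \<open>Abstract simplicial complexes and their realizations\<close>

text \<open>
  Complexes are abstract: a complex is the set of its (nonempty, finite) simplices, and its
  vertex set is the union of these. The constant \<open>simplicial_complex\<close> of \<open>HOL-Analysis\<close> is about
  geometric complexes embedded in a Euclidean space.
\<close>

definition abstract_complex :: "'v set set \<Rightarrow> bool" where
  "abstract_complex K \<longleftrightarrow>
     (\<forall>\<sigma>\<in>K. finite \<sigma> \<and> \<sigma> \<noteq> {}) \<and> (\<forall>\<sigma>\<in>K. \<forall>\<tau>. \<tau> \<subseteq> \<sigma> \<and> \<tau> \<noteq> {} \<longrightarrow> \<tau> \<in> K)"

definition subcomplex :: "'v set set \<Rightarrow> 'v set set \<Rightarrow> bool" where
  "subcomplex L K \<longleftrightarrow> abstract_complex L \<and> L \<subseteq> K"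

text \<open>
  A point of the realization is its family of barycentric coordinates. The topology is the one
  inherited from the product topology on \<open>'v \<Rightarrow> real\<close>, which for a finite complex is the
  usual topology of the realization.
\<close>

definition realization :: "'v set set \<Rightarrow> ('v \<Rightarrow> real) set" where
  "realization K =
     {f. (\<forall>v. 0 \<le> f v) \<and> {v. f v \<noteq> 0} \<in> K \<and> (\<Sum>v | f v \<noteq> 0. f v) = 1}"

definition closed_simplex :: "'v set \<Rightarrow> ('v \<Rightarrow> real) set" where
  "closed_simplex \<sigma> = realization {\<tau>. \<tau> \<subseteq> \<sigma> \<and> \<tau> \<noteq> {}}"

text \<open>First barycentric subdivision: its vertices are the simplices of \<open>K\<close>.\<close>

definition Sd :: "'v set set \<Rightarrow> 'v set set set" where
  "Sd K = {C. C \<subseteq> K \<and> finite C \<and> C \<noteq> {} \<and> chain_subset C}"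

definition barycenter :: "'v set \<Rightarrow> 'v \<Rightarrow> real" where
  "barycenter \<sigma> v = (if v \<in> \<sigma> then 1 / real (card \<sigma>) else 0)"

text \<open>
  The canonical identification of \<open>|Sd K|\<close> with \<open>|K|\<close>: affine on each simplex, sending the
  vertex \<open>\<sigma>\<close> to the barycenter of \<open>\<sigma>\<close>.
\<close>

definition sd_map :: "('v set \<Rightarrow> real) \<Rightarrow> 'v \<Rightarrow> real" where
  "sd_map f = (\<lambda>v. \<Sum>\<sigma> | f \<sigma> \<noteq> 0. f \<sigma> * barycenter \<sigma> v)"


section \<open>Ordered complexes and their powers\<close>

definition ordered_complex :: "'v set set \<Rightarrow> 'v rel \<Rightarrow> bool" where
  "ordered_complex X r \<longleftrightarrow>
     abstract_complex X \<and> partial_order_on (\<Union>X) r \<and> (\<forall>\<sigma>\<in>X. total_on \<sigma> r)"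

text \<open>
  An \<open>n\<close>-tuple is a function on a finite index type \<open>'n\<close> with \<open>n\<close> elements, so \<open>n \<ge> 1\<close>.
  In the following definition \<open>w 0, \<dots>, w q\<close> are the vertices of a \<open>q\<close>-simplex of the \<open>n\<close>-th power.
\<close>

definition power_complex :: "'v set set \<Rightarrow> 'v rel \<Rightarrow> ('n::finite \<Rightarrow> 'v) set set" where
  "power_complex X r =
     {w ` {..q} | (w :: nat \<Rightarrow> 'n \<Rightarrow> 'v) q.
        inj_on w {..q} \<and>
        (\<forall>k. (\<exists>\<sigma>\<in>X. \<forall>j\<le>q. w j k \<in> \<sigma>) \<and> (\<forall>j<q. (w j k, w (Suc j) k) \<in> r))}"

text \<open>
  The canonical identification of \<open>|X^n|\<close> with \<open>|X|^n\<close>: its \<open>k\<close>-th component is the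
  realization of the simplicial map taking a vertex \<open>w\<close> of \<open>X^n\<close> to its \<open>k\<close>-th coordinate.
\<close>

definition power_map :: "(('n::finite \<Rightarrow> 'v) \<Rightarrow> real) \<Rightarrow> 'n \<Rightarrow> 'v \<Rightarrow> real" where
  "power_map f = (\<lambda>k v. \<Sum>w | f w \<noteq> 0 \<and> w k = v. f w)"

definition sd_power_map :: "(('n::finite \<Rightarrow> 'v) set \<Rightarrow> real) \<Rightarrow> 'n \<Rightarrow> 'v \<Rightarrow> real" where
  "sd_power_map f = power_map (sd_map f)"


section \<open>Diagonals and configuration spaces\<close>

definition power_space :: "'a set \<Rightarrow> ('n::finite \<Rightarrow> 'a) set" where
  "power_space Y = {x. \<forall>k. x k \<in> Y}"

text \<open>
  \<open>\<Delta>\<^sub>m(Y,n)\<close>: some \<open>m\<close> of the \<open>n\<close> coordinates coincide. Choosing indices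
  \<open>i\<^sub>0 < \<dots> < i\<^sub>d\<close> amounts to choosing a set \<open>I\<close> of \<open>m = d + 1\<close> indices.
\<close>

definition fat_diagonal :: "nat \<Rightarrow> 'a set \<Rightarrow> ('n::finite \<Rightarrow> 'a) set" where
  "fat_diagonal m Y =
     {x \<in> power_space Y. \<exists>I. card I = m \<and> (\<forall>i\<in>I. \<forall>j\<in>I. x i = x j)}"

text \<open>\<open>\<Delta>\<^sup>d(Y,n)\<close>\<close>

definition config_space :: "nat \<Rightarrow> 'a set \<Rightarrow> ('n::finite \<Rightarrow> 'a) set" where
  "config_space d Y = power_space Y - fat_diagonal (d + 1) Y"

text \<open>
  \<open>\<Delta>\<^sub>m(X,n)\<close> as a subcomplex of \<open>X^n\<close>: the simplices of \<open>X^n\<close> that lie in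
  \<open>\<Delta>\<^sub>m(|X|,n)\<close>.
\<close>

definition diagonal_complex :: "nat \<Rightarrow> 'v set set \<Rightarrow> 'v rel \<Rightarrow> ('n::finite \<Rightarrow> 'v) set set" where
  "diagonal_complex m X r =
     {S \<in> power_complex X r. power_map ` closed_simplex S \<subseteq> fat_diagonal m (realization X)}"


section \<open>The largest subcomplex missing a set\<close>

definition largest_subcomplex_avoiding :: "'v set set \<Rightarrow> ('v \<Rightarrow> real) set \<Rightarrow> 'v set set" where
  "largest_subcomplex_avoiding K A =
     (GREATEST L. subcomplex L K \<and> realization L \<inter> A = {})"

text \<open>There is indeed a largest such subcomplex, namely the union of all of them.\<close>

lemma largest_subcomplex_avoiding_eq:
  "largest_subcomplex_avoiding K A =
     \<Union> {L. subcomplex L K \<and> realization L \<inter> A = {}}" (is ?eq)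
  and subcomplex_largest_subcomplex_avoiding:
    "subcomplex (largest_subcomplex_avoiding K A) K" (is ?sub)
  and realization_largest_subcomplex_avoiding:
    "realization (largest_subcomplex_avoiding K A) \<inter> A = {}" (is ?disj)
proof -
  define P where "P L \<longleftrightarrow> subcomplex L K \<and> realization L \<inter> A = {}" for L
  have sub: "subcomplex (\<Union>(Collect P)) K"
    unfolding subcomplex_def abstract_complex_def
  proof (intro conjI ballI allI impI)
    fix \<sigma> assume "\<sigma> \<in> \<Union>(Collect P)"
    then obtain L where L: "P L" "\<sigma> \<in> L" by auto
    then show "finite \<sigma>" "\<sigma> \<noteq> {}"
      by (auto simp: P_def subcomplex_def abstract_complex_def)
    fix \<tau> assume "\<tau> \<subseteq> \<sigma> \<and> \<tau> \<noteq> {}"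
    with L have "\<tau> \<in> L"
      unfolding P_def subcomplex_def abstract_complex_def by metis
    with L show "\<tau> \<in> \<Union>(Collect P)" by auto
  qed (auto simp: P_def subcomplex_def)
  have "realization (\<Union>(Collect P)) = (\<Union>L\<in>Collect P. realization L)"
    by (auto simp: realization_def)
  then have disj: "realization (\<Union>(Collect P)) \<inter> A = {}"
    by (auto simp: P_def)
  have "(GREATEST L. P L) = \<Union>(Collect P)"
  proof (rule Greatest_equality)
    show "P (\<Union>(Collect P))"
      using sub disj by (simp only: P_def simp_thms)
  qed (simp add: Union_upper)
  then have eq: "largest_subcomplex_avoiding K A = \<Union>(Collect P)"
    by (simp only: largest_subcomplex_avoiding_def P_def)
  then show ?eq
    unfolding P_def[abs_def] .
  show ?sub
    unfolding eq by (fact sub)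
  show ?disj
    unfolding eq by (fact disj)
qed

text \<open>\<open>W\<^sup>d(X,n)\<close>\<close>

definition W_complex :: "nat \<Rightarrow> 'v set set \<Rightarrow> 'v rel \<Rightarrow> ('n::finite \<Rightarrow> 'v) set set set" where
  "W_complex d X r =
     largest_subcomplex_avoiding (Sd (power_complex X r))
       (realization (Sd (diagonal_complex (d + 1) X r)))"


section \<open>Equivariant deformation retractions\<close>

text \<open>The permutation \<open>\<pi>\<close> moves the \<open>i\<close>-th coordinate to position \<open>\<pi> i\<close>.\<close>

definition permute_coords :: "('n \<Rightarrow> 'n) \<Rightarrow> ('n \<Rightarrow> 'a) \<Rightarrow> 'n \<Rightarrow> 'a" where
  "permute_coords \<pi> x = x \<circ> inv \<pi>"

text \<open>
  \<open>\<rho>\<close> is the end map of a deformation retraction of \<open>A\<close> onto \<open>B\<close>; the points of \<open>B\<close> stay fixed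
  and the maps are equivariant throughout the homotopy.
\<close>

definition equivariant_deformation_retraction ::
    "'g set \<Rightarrow> ('g \<Rightarrow> 'a \<Rightarrow> 'a) \<Rightarrow> 'a::topological_space set \<Rightarrow> 'a set \<Rightarrow> ('a \<Rightarrow> 'a) \<Rightarrow> bool" where
  "equivariant_deformation_retraction G act A B \<rho> \<longleftrightarrow>
     retraction A B \<rho> \<and>
     homotopic_with_canon
       (\<lambda>f. (\<forall>x\<in>B. f x = x) \<and> (\<forall>g\<in>G. \<forall>x\<in>A. f (act g x) = act g (f x))) A A id \<rho>"

end

theory Submission
  imports Defs
begin

text \<open>
  Both \<open>sd_map\<close> and \<open>power_map\<close> are bijective because a point determines a weighted chain
  whose extreme member, with its weight, can be read off and peeled off; compactness makes them
  homeomorphisms. As \<open>Sd(\<Delta>)\<close> is a full subcomplex of \<open>Sd(X\<^sup>n)\<close>, the barycentric coordinates at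
  its vertices can be scaled down to \<open>0\<close> and the others renormalised. This moves the complement
  of \<open>|Sd(\<Delta>)|\<close> onto \<open>W\<close>, whose simplices are the chains without a member in \<open>\<Delta>\<close>, and it
  commutes with every permutation of the vertices that preserves \<open>\<Delta>\<close>.
\<close>

section \<open>Realizations\<close>

text \<open>Subdividing is what makes the diagonal full. For \<open>X\<close> an edge, three
  coordinates and \<open>d = 1\<close>, every vertex of the power repeats a coordinate, yet the
  simplex (0,0,0), (0,0,1), (0,1,1), (1,1,1) is not in the diagonal; without subdivision only the
  empty subcomplex would miss the diagonal. In the subdivision fullness is automatic, since a chain
  of simplices that all belong to the diagonal is a simplex of its subdivision. Peeling lowers the
  total mass and leaves the given realization. Uniqueness is therefore proved for
  \<open>chain_weight\<close> and \<open>tuple_weight\<close>, which fix neither the mass nor the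
  complex; the complex returns afterwards through a comparison of supports. The combinatorial
  diagonal matches the geometric one only if equal coordinates of a point mean equal coordinates of
  every vertex in its support. This rests on the injectivity of \<open>power_map\<close> and the
  antisymmetry of the order.\<close>

lemma abstract_complexD:
  assumes "abstract_complex K" "\<sigma> \<in> K"
  shows "finite \<sigma>" "\<sigma> \<noteq> {}" "\<And>\<tau>. \<tau> \<subseteq> \<sigma> \<Longrightarrow> \<tau> \<noteq> {} \<Longrightarrow> \<tau> \<in> K"
  using assms unfolding abstract_complex_def by blast+

lemma sum_support_superset:
  fixes f :: "'v \<Rightarrow> real"
  assumes "finite V" "{v. f v \<noteq> 0} \<subseteq> V"
  shows "(\<Sum>v | f v \<noteq> 0. f v) = sum f V"
  by (rule sum.mono_neutral_left) (use assms in auto)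

text \<open>Replaces the exact support by any simplex that contains it, a condition that survives
  limits and the vanishing of coordinates. Passing back to the support uses closure under faces; the
  sum 1 keeps the support nonempty.\<close>

lemma realization_iff:
  assumes "abstract_complex K"
  shows "f \<in> realization K \<longleftrightarrow> (\<forall>v. 0 \<le> f v) \<and> (\<exists>\<sigma>\<in>K. (\<forall>v. v \<notin> \<sigma> \<longrightarrow> f v = 0) \<and> sum f \<sigma> = 1)"
proof (intro iffI; (elim conjE bexE)?)
  assume "f \<in> realization K"
  then show "(\<forall>v. 0 \<le> f v) \<and> (\<exists>\<sigma>\<in>K. (\<forall>v. v \<notin> \<sigma> \<longrightarrow> f v = 0) \<and> sum f \<sigma> = 1)"
    unfolding realization_def by (intro conjI bexI[of _ "{v. f v \<noteq> 0}"]) simp_all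
next
  fix \<sigma> assume f: "\<forall>v. 0 \<le> f v" "\<sigma> \<in> K" "\<forall>v. v \<notin> \<sigma> \<longrightarrow> f v = 0" "sum f \<sigma> = 1"
  have "finite \<sigma>" "\<And>\<tau>. \<tau> \<subseteq> \<sigma> \<Longrightarrow> \<tau> \<noteq> {} \<Longrightarrow> \<tau> \<in> K"
    using abstract_complexD[OF assms f(2)] by blast+
  moreover from this f have s: "(\<Sum>v | f v \<noteq> 0. f v) = 1"
    using sum_support_superset[of \<sigma> f] by auto
  moreover have "{v. f v \<noteq> 0} \<noteq> {}"
    using s by (metis sum.empty zero_neq_one)
  moreover have "{v. f v \<noteq> 0} \<subseteq> \<sigma>"
    using f by auto
  ultimately show "f \<in> realization K"
    using f by (auto simp: realization_def)
qed

lemma finite_vertices: "abstract_complex K \<Longrightarrow> finite K \<Longrightarrow> finite (\<Union>K)"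
  by (metis abstract_complexD(1) finite_Union)

text \<open>Each closed simplex is cut out of the Tychonoff cube by closed conditions on
  coordinates, whatever the size of the vertex type, and there are finitely many simplices.\<close>

lemma compact_realization:
  fixes K :: "'v set set"
  assumes "abstract_complex K" "finite K"
  shows "compact (realization K)"
proof -
  define R where "R \<sigma> = {f :: 'v \<Rightarrow> real. (\<forall>v. 0 \<le> f v) \<and> (\<forall>v. v \<notin> \<sigma> \<longrightarrow> f v = 0) \<and> sum f \<sigma> = 1}" for \<sigma>
  have "compact (R \<sigma>)" if "\<sigma> \<in> K" for \<sigma>
  proof -
    have fin: "finite \<sigma>"
      using abstract_complexD[OF assms(1) that] by blast
    define P where "P = (\<Pi>\<^sub>E v\<in>(UNIV :: 'v set). {0..1 :: real})"
    have "compactin (product_topology (\<lambda>_. euclidean) UNIV) P"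
      unfolding P_def by (subst compactin_PiE) (auto simp: compactin_euclidean_iff)
    then have "compact P"
      by (simp add: euclidean_product_topology compactin_euclidean_iff)
    moreover have "closed (R \<sigma>)"
    proof -
      have "R \<sigma> = (\<Inter>v. {f. 0 \<le> f v}) \<inter> (\<Inter>v\<in>-\<sigma>. {f. f v = 0}) \<inter> {f. sum f \<sigma> = 1}"
        by (auto simp: R_def)
      moreover have "closed {f :: 'v \<Rightarrow> real. 0 \<le> f v}" "closed {f :: 'v \<Rightarrow> real. f v = 0}" for v
        by (auto intro!: closed_Collect_le closed_Collect_eq continuous_on_const continuous_on_product_coordinates)
      moreover have "closed {f :: 'v \<Rightarrow> real. sum f \<sigma> = 1}"
        by (intro closed_Collect_eq continuous_on_const continuous_on_sum continuous_on_product_coordinates)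
      ultimately show ?thesis
        by (simp add: closed_INT closed_Int)
    qed
    moreover have "R \<sigma> \<subseteq> P"
    proof
      fix f assume f: "f \<in> R \<sigma>"
      have "f v \<le> 1" for v
        using f member_le_sum[of v \<sigma> f] fin by (cases "v \<in> \<sigma>") (auto simp: R_def)
      then show "f \<in> P"
        using f by (auto simp: R_def P_def)
    qed
    ultimately show ?thesis
      by (metis closed_Int_compact inf.absorb1)
  qed
  moreover have "realization K = (\<Union>\<sigma>\<in>K. R \<sigma>)"
    unfolding R_def by (simp only: set_eq_iff UN_iff mem_Collect_eq realization_iff[OF assms(1)] bex_simps simp_thms)
  ultimately show ?thesis
    using assms(2) by auto
qed

text \<open>The support of \<open>f \<circ> q\<close> is the preimage of the support of
  \<open>f\<close>, so invariance of the complex is asked for preimages.\<close>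

lemma realization_comp_bij:
  assumes f: "f \<in> realization L" and q: "bij q" and L: "\<And>C. C \<in> L \<Longrightarrow> q -` C \<in> L"
  shows "f \<circ> q \<in> realization L"
proof -
  define C where "C = {v. f v \<noteq> 0}"
  have qC: "{v. (f \<circ> q) v \<noteq> 0} = q -` C"
    by (auto simp: C_def)
  have "sum (f \<circ> q) (q -` C) = sum f (q ` (q -` C))"
    by (rule sum.reindex[symmetric]) (rule inj_on_subset[OF bij_is_inj[OF q] subset_UNIV])
  moreover have "q ` (q -` C) = C"
    by (rule surj_image_vimage_eq[OF bij_is_surj[OF q]])
  moreover have "sum f C = 1" "C \<in> L" "\<And>v. 0 \<le> f v"
    using f unfolding realization_def C_def by blast+
  ultimately show ?thesis
    unfolding realization_def mem_Collect_eq qC using L by simp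
qed

text \<open>Compact to Hausdorff: continuity of the inverse comes without a formula for it. The
  codomain has the shape of that of \<open>sd_power_map\<close>.\<close>

lemma homeomorphism_compact_fun:
  fixes h :: "'a::topological_space \<Rightarrow> ('b \<Rightarrow> 'c \<Rightarrow> real)"
  assumes "compact S" "continuous_on S h" "bij_betw h S T"
  shows "\<exists>g. homeomorphism S T h g"
proof -
  have "Hausdorff_space (euclidean :: ('b \<Rightarrow> 'c \<Rightarrow> real) topology)"
    unfolding euclidean_product_topology[symmetric] Hausdorff_space_product_topology by simp
  then have "Hausdorff_space (top_of_set T)"
    by (rule Hausdorff_space_subtopology)
  moreover have "h ` S = T" "inj_on h S"
    using assms(3) by (auto simp: bij_betw_def)
  ultimately have "homeomorphic_map (top_of_set S) (top_of_set T) h"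
    using assms by (intro continuous_imp_homeomorphic_map) (auto simp: compact_space_subtopology)
  then obtain g where "homeomorphic_maps (top_of_set S) (top_of_set T) h g"
    by (auto simp: homeomorphic_map_maps)
  then show ?thesis
    by (auto simp: homeomorphic_maps_def homeomorphism_def intro!: exI[of _ g]) force+
qed

section \<open>The barycentric subdivision\<close>

lemma chain_subset_mono: "chain_subset C \<Longrightarrow> D \<subseteq> C \<Longrightarrow> chain_subset D"
  by (auto simp: chain_subset_def)

lemma abstract_complex_Sd: "abstract_complex (Sd K)"
  by (auto simp: abstract_complex_def Sd_def finite_subset intro: chain_subset_mono)

lemma finite_Sd: "finite K \<Longrightarrow> finite (Sd K)"
  by (rule finite_subset[of _ "Pow K"]) (auto simp: Sd_def)

text \<open>Lifts a symmetry \<open>p\<close> of the vertices of \<open>K\<close> to the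
  subdivision, whose vertices it moves by \<open>image p\<close>.\<close>

lemma Sd_vimage:
  assumes "bij p" "\<And>S. S \<in> K \<Longrightarrow> p -` S \<in> K" "C \<in> Sd K"
  shows "image p -` C \<in> Sd K"
  unfolding Sd_def
proof (intro CollectI conjI)
  have inj: "inj p" and surj: "surj p"
    using assms(1) by (auto simp: bij_def)
  show "image p -` C \<subseteq> K"
    using assms(2,3) inj_vimage_image_eq[OF inj] by (auto simp: Sd_def) (metis subsetD)
  show "finite (image p -` C)"
    using assms(3) inj by (intro finite_vimageI) (auto simp: Sd_def inj_image_eq_iff intro: injI)
  obtain S where "S \<in> C"
    using assms(3) by (auto simp: Sd_def)
  then have "p -` S \<in> image p -` C"
    by (simp add: surj surj_image_vimage_eq)
  then show "image p -` C \<noteq> {}"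
    by blast
  show "chain_subset (image p -` C)"
    using assms(3) by (auto simp: Sd_def chain_subset_def inj_image_subset_iff[OF inj])
      (metis inj inj_image_subset_iff subsetD)
qed

section \<open>Weighted chains of simplices and the affine map to the unsubdivided complex\<close>

lemma sd_map_superset:
  assumes "finite A" "{\<sigma>. g \<sigma> \<noteq> 0} \<subseteq> A"
  shows "sd_map g v = (\<Sum>\<sigma>\<in>A. g \<sigma> * barycenter \<sigma> v)"
  unfolding sd_map_def by (rule sum.mono_neutral_left) (use assms in auto)

text \<open>A bijection preserves cardinalities, hence takes barycenters to barycenters.\<close>

lemma sd_map_comp_bij:
  assumes "bij p"
  shows "sd_map (g \<circ> image p) = sd_map g \<circ> p"
proof
  fix v
  have b: "barycenter \<sigma> v = barycenter (p ` \<sigma>) (p v)" for \<sigma>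
    using bij_is_inj[OF assms]
    by (auto simp: barycenter_def inj_image_mem_iff card_image[OF inj_on_subset])
  have "sd_map (g \<circ> image p) v = (\<Sum>\<sigma> | g (p ` \<sigma>) \<noteq> 0. g (p ` \<sigma>) * barycenter (p ` \<sigma>) (p v))"
    by (simp add: sd_map_def b)
  also have "\<dots> = sd_map g (p v)"
    unfolding sd_map_def
    by (rule sum.reindex_bij_witness[where i = "image (inv p)" and j = "image p"])
      (use assms in \<open>auto simp: image_comp bij_is_inj bij_is_surj surj_f_inv_f\<close>)
  finally show "sd_map (g \<circ> image p) v = (sd_map g \<circ> p) v"
    by simp
qed

text \<open>A point of a subdivision without reference to a complex and without the normalisation to
  mass 1, so that removing a simplex from the chain stays within the notion.\<close>

definition chain_weight :: "('v set \<Rightarrow> real) \<Rightarrow> bool" where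
  "chain_weight g \<longleftrightarrow> (\<forall>\<sigma>. 0 \<le> g \<sigma>) \<and> finite {\<sigma>. g \<sigma> \<noteq> 0} \<and> chain_subset {\<sigma>. g \<sigma> \<noteq> 0} \<and>
     (\<forall>\<sigma>. g \<sigma> \<noteq> 0 \<longrightarrow> finite \<sigma> \<and> \<sigma> \<noteq> {})"

lemma barycenter_nonneg [simp]: "0 \<le> barycenter \<sigma> v"
  by (simp add: barycenter_def)

lemma sd_map_nonneg: "chain_weight g \<Longrightarrow> 0 \<le> sd_map g v"
  by (auto simp: sd_map_def chain_weight_def intro!: sum_nonneg)

lemma sd_map_ge:
  assumes "chain_weight g" "v \<in> \<sigma>"
  shows "g \<sigma> / card \<sigma> \<le> sd_map g v"
proof (cases "g \<sigma> = 0")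
  case False
  then have "g \<sigma> * barycenter \<sigma> v \<le> sd_map g v"
    unfolding sd_map_def
    by (intro member_le_sum) (use assms in \<open>auto simp: chain_weight_def\<close>)
  then show ?thesis
    using assms by (simp add: barycenter_def)
qed (use assms sd_map_nonneg in auto)

lemma sd_map_support:
  assumes "chain_weight g"
  shows "{v. sd_map g v \<noteq> 0} = \<Union>{\<sigma>. g \<sigma> \<noteq> 0}"
proof (intro equalityI subsetI)
  fix v assume "v \<in> {v. sd_map g v \<noteq> 0}"
  then obtain \<sigma> where "g \<sigma> \<noteq> 0" "g \<sigma> * barycenter \<sigma> v \<noteq> 0"
    unfolding sd_map_def by (auto elim: sum.not_neutral_contains_not_neutral)
  then show "v \<in> \<Union>{\<sigma>. g \<sigma> \<noteq> 0}"
    by (auto simp: barycenter_def split: if_splits)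
next
  fix v assume "v \<in> \<Union>{\<sigma>. g \<sigma> \<noteq> 0}"
  then obtain \<sigma> where "g \<sigma> \<noteq> 0" "v \<in> \<sigma>"
    by auto
  moreover from this have "0 < g \<sigma> / card \<sigma>"
    using assms by (auto simp: chain_weight_def card_gt_0_iff less_le)
  ultimately show "v \<in> {v. sd_map g v \<noteq> 0}"
    using sd_map_ge[OF assms, of v \<sigma>] by auto
qed

text \<open>Recovers the top simplex of a chain from the support of its image under
  \<open>sd_map\<close>, which is the union of the chain.\<close>

lemma chain_subset_Union_in:
  assumes "finite C" "C \<noteq> {}" "chain_subset C"
  shows "\<Union>C \<in> C"
  using assms
proof (induction C rule: finite_ne_induct)
  case (insert \<sigma> C)
  then have "\<Union>C \<in> C"
    by (auto simp: chain_subset_def)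
  moreover have "\<sigma> \<subseteq> \<Union>C \<or> \<Union>C \<subseteq> \<sigma>"
    using insert.prems calculation by (auto simp: chain_subset_def)
  ultimately show ?case
    by (auto simp: Un_absorb1 Un_absorb2)
qed auto

lemma sd_map_upd:
  assumes "chain_weight g" "g S = 0"
  shows "sd_map (g(S := a)) v = sd_map g v + a * barycenter S v"
proof -
  let ?A = "insert S {\<sigma>. g \<sigma> \<noteq> 0}"
  have fin: "finite {\<sigma>. g \<sigma> \<noteq> 0}"
    using assms by (auto simp: chain_weight_def)
  have "sd_map (g(S := a)) v = (\<Sum>\<sigma>\<in>?A. (g(S := a)) \<sigma> * barycenter \<sigma> v)"
    by (rule sd_map_superset) (use fin in \<open>auto\<close>)
  also have "\<dots> = a * barycenter S v + (\<Sum>\<sigma> | g \<sigma> \<noteq> 0. g \<sigma> * barycenter \<sigma> v)"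
    using fin assms(2) by (subst sum.insert) (auto intro!: sum.cong)
  finally show ?thesis
    by (simp add: sd_map_def)
qed

text \<open>
  The top simplex of the chain is the support \<open>S\<close> of \<open>f\<close>, and its weight is forced, because some
  vertex of \<open>S\<close> lies in no other simplex of the chain; now peel it off.
\<close>

lemma ex1_chain_weight:
  fixes f :: "'v \<Rightarrow> real"
  assumes "finite {v. f v \<noteq> 0}" "\<And>v. 0 \<le> f v"
  shows "\<exists>!g. chain_weight g \<and> sd_map g = f"
  using assms
proof (induction "card {v. f v \<noteq> 0}" arbitrary: f rule: less_induct)
  case less
  define S where "S = {v. f v \<noteq> 0}"
  have finS: "finite S"
    using less by (simp add: S_def)
  show ?case
  proof (cases "S = {}")
    case True
    then have f0: "f = (\<lambda>_. 0)"
      by (auto simp: S_def)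
    show ?thesis
    proof (rule ex1I[of _ "\<lambda>_. 0"])
      show "chain_weight (\<lambda>_. 0) \<and> sd_map (\<lambda>_. 0) = f"
        by (simp add: f0 chain_weight_def sd_map_def chain_subset_def)
      fix g assume g: "chain_weight g \<and> sd_map g = f"
      then have "\<Union>{\<sigma>. g \<sigma> \<noteq> 0} = {}"
        using sd_map_support[of g] f0 by auto
      then show "g = (\<lambda>_. 0)"
        using g by (auto simp: chain_weight_def)
    qed
  next
    case False
    \<comment> \<open>A weight on \<open>S\<close> adds the same amount at every vertex of
      \<open>S\<close>. The minimum is the most that can be subtracted uniformly, and it empties at
      least one vertex, so the support shrinks.\<close>
    define c where "c = Min (f ` S)"
    define f' where "f' v = (if v \<in> S then f v - c else 0)" for v
    have c_le: "c \<le> f v" if "v \<in> S" for v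
      using that finS by (simp add: c_def)
    have "c \<in> f ` S"
      unfolding c_def using finS False by (intro Min_in) auto
    then obtain v0 where v0: "v0 \<in> S" "f v0 = c"
      by auto
    have c_pos: "c > 0"
      using v0 less.prems(2)[of v0] by (auto simp: S_def less_le)
    have sub: "{v. f' v \<noteq> 0} \<subset> S"
      using v0 by (auto simp: f'_def)
    have "\<exists>!g. chain_weight g \<and> sd_map g = f'"
    proof (rule less.hyps)
      show "card {v. f' v \<noteq> 0} < card {v. f v \<noteq> 0}"
        using sub finS psubset_card_mono S_def by blast
      show "finite {v. f' v \<noteq> 0}"
        using sub finS finite_subset by blast
      show "0 \<le> f' v" for v
        using c_le by (auto simp: f'_def)
    qed
    then obtain g' where g': "chain_weight g'" "sd_map g' = f'"
      and uniq: "\<And>g. chain_weight g \<Longrightarrow> sd_map g = f' \<Longrightarrow> g = g'"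
      by blast
    have supp': "\<sigma> \<subset> S" if "g' \<sigma> \<noteq> 0" for \<sigma>
      using sd_map_support[OF g'(1)] g'(2) sub that by auto
    then have g'S: "g' S = 0"
      by blast
    \<comment> \<open>The barycenter of \<open>S\<close> has coordinates \<open>1 / card S\<close>,
      so this weight adds exactly \<open>c\<close> at each vertex.\<close>
    let ?a = "c * card S"
    have card: "card S > 0"
      using False finS by (simp add: card_gt_0_iff)
    show ?thesis
    proof (rule ex1I[of _ "g'(S := ?a)"], intro conjI)
      have eq: "{\<sigma>. (g'(S := ?a)) \<sigma> \<noteq> 0} = insert S {\<sigma>. g' \<sigma> \<noteq> 0}"
        using c_pos card by auto
      show "chain_weight (g'(S := ?a))"
        unfolding chain_weight_def eq
        using g'(1) c_pos finS False supp' by (auto simp: chain_weight_def chain_subset_def)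
      show "sd_map (g'(S := ?a)) = f"
      proof
        fix v
        have "f v = f' v + ?a * barycenter S v"
        proof (cases "v \<in> S")
          case False
          then show ?thesis
            by (simp add: f'_def barycenter_def) (simp add: S_def)
        qed (use card in \<open>simp add: f'_def barycenter_def\<close>)
        then show "sd_map (g'(S := ?a)) v = f v"
          by (simp add: sd_map_upd[OF g'(1) g'S] g'(2))
      qed
      fix g assume g: "chain_weight g \<and> sd_map g = f"
      let ?C = "{\<sigma>. g \<sigma> \<noteq> 0}"
      have US: "\<Union>?C = S"
        using sd_map_support[of g] g by (simp only: S_def)
      have C: "finite ?C" "chain_subset ?C"
        using g by (auto simp: chain_weight_def)
      have "?C \<noteq> {}"
        using US False by auto
      then have SC: "g S \<noteq> 0"
        using chain_subset_Union_in[OF C(1) _ C(2)] US by auto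
      define h where "h = g(S := 0)"
      have hC: "{\<sigma>. h \<sigma> \<noteq> 0} = ?C - {S}"
        by (auto simp: h_def)
      have cwh: "chain_weight h"
        using g chain_subset_mono[OF C(2), of "?C - {S}"]
        unfolding chain_weight_def hC by (auto simp: h_def)
      have gh: "g = h(S := g S)" "h S = 0"
        by (auto simp: h_def)
      have f_eq: "f v = sd_map h v + g S * barycenter S v" for v
        using sd_map_upd[OF cwh gh(2), of "g S" v] gh(1) g by simp
      have "\<Union>(?C - {S}) \<noteq> S"
      proof (cases "?C - {S} = {}")
        case False
        then show ?thesis
          using chain_subset_Union_in[of "?C - {S}"] C chain_subset_mono[OF C(2), of "?C - {S}"] by auto
      qed (use \<open>S \<noteq> {}\<close> in auto)
      \<comment> \<open>At \<open>v1\<close> only \<open>S\<close> contributes, so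
        \<open>f v1 = g S / card S\<close>, which is at least the minimum \<open>c\<close>. At the
        minimiser \<open>v0\<close> the contribution of \<open>S\<close> is at most
        \<open>f v0 = c\<close>. Hence \<open>g S\<close> is forced.\<close>
      then obtain v1 where v1: "v1 \<in> S" "v1 \<notin> \<Union>(?C - {S})"
        using US by auto
      then have "sd_map h v1 = 0"
        using sd_map_support[OF cwh] hC by auto
      then have "c \<le> g S / card S"
        using f_eq[of v1] v1 c_le[of v1] by (simp add: barycenter_def)
      moreover have "g S / card S \<le> c"
        using sd_map_ge[of g v0 S] g v0 by auto
      ultimately have gS: "g S = ?a"
        using card by (simp add: field_simps)
      have "sd_map h = f'"
        using f_eq gS card sd_map_support[OF cwh] hC US
        by (auto simp: fun_eq_iff f'_def barycenter_def)
      then have "h = g'"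
        using uniq cwh by blast
      then show "g = g'(S := ?a)"
        using gh gS by metis
    qed
  qed
qed

text \<open>Every barycenter has total mass 1; interchange the two sums.\<close>

lemma sum_sd_map:
  assumes "chain_weight g"
  shows "(\<Sum>v | sd_map g v \<noteq> 0. sd_map g v) = (\<Sum>\<sigma> | g \<sigma> \<noteq> 0. g \<sigma>)"
proof -
  let ?V = "\<Union>{\<sigma>. g \<sigma> \<noteq> 0}"
  have fin: "finite ?V"
    using assms by (auto simp: chain_weight_def)
  have "(\<Sum>v\<in>?V. barycenter \<sigma> v) = 1" if "g \<sigma> \<noteq> 0" for \<sigma>
  proof -
    have "(\<Sum>v\<in>?V. barycenter \<sigma> v) = (\<Sum>v\<in>\<sigma>. barycenter \<sigma> v)"
      by (rule sum.mono_neutral_right) (use fin that in \<open>auto simp: barycenter_def\<close>)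
    also have "\<dots> = 1"
      using assms that by (simp add: barycenter_def chain_weight_def)
    finally show ?thesis .
  qed
  then have "(\<Sum>\<sigma> | g \<sigma> \<noteq> 0. g \<sigma>) = (\<Sum>\<sigma> | g \<sigma> \<noteq> 0. \<Sum>v\<in>?V. g \<sigma> * barycenter \<sigma> v)"
    by (simp flip: sum_distrib_left)
  also have "\<dots> = (\<Sum>v\<in>?V. sd_map g v)"
    unfolding sd_map_def by (rule sum.swap)
  finally show ?thesis
    using sd_map_support[OF assms] by simp
qed

text \<open>The support of \<open>sd_map g\<close> is the top simplex of the chain. Closure under
  faces puts the whole chain in \<open>K\<close> as soon as the top is there, so \<open>K\<close>
  enters only through the image point.\<close>

lemma realization_Sd_iff:
  assumes "abstract_complex K"
  shows "g \<in> realization (Sd K) \<longleftrightarrow> chain_weight g \<and> sd_map g \<in> realization K"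
proof
  assume g: "g \<in> realization (Sd K)"
  then have "chain_weight g"
    using abstract_complexD(1,2)[OF assms]
    unfolding realization_def Sd_def chain_weight_def by blast
  moreover from this have "\<Union>{\<sigma>. g \<sigma> \<noteq> 0} \<in> K"
    using g chain_subset_Union_in[of "{\<sigma>. g \<sigma> \<noteq> 0}"] by (auto simp: realization_def Sd_def)
  ultimately show "chain_weight g \<and> sd_map g \<in> realization K"
    using g sum_sd_map[of g] sd_map_support[of g] sd_map_nonneg[of g]
    by (auto simp: realization_def)
next
  assume g: "chain_weight g \<and> sd_map g \<in> realization K"
  then have "\<Union>{\<sigma>. g \<sigma> \<noteq> 0} \<in> K"
    using sd_map_support[of g] by (auto simp: realization_def)
  then have "{\<sigma>. g \<sigma> \<noteq> 0} \<subseteq> K"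
    using g abstract_complexD(3)[OF assms, of "\<Union>{\<sigma>. g \<sigma> \<noteq> 0}"] unfolding chain_weight_def by blast
  moreover have "(\<Sum>\<sigma> | g \<sigma> \<noteq> 0. g \<sigma>) = 1"
    using g sum_sd_map[of g] by (auto simp: realization_def)
  moreover from this have "{\<sigma>. g \<sigma> \<noteq> 0} \<noteq> {}"
    by (metis sum.empty zero_neq_one)
  ultimately show "g \<in> realization (Sd K)"
    using g by (auto simp: realization_def Sd_def chain_weight_def)
qed

lemma bij_betw_sd_map:
  assumes "abstract_complex K"
  shows "bij_betw sd_map (realization (Sd K)) (realization K)"
proof (rule bij_betw_imageI)
  have ex1: "\<exists>!g. chain_weight g \<and> sd_map g = f" if "f \<in> realization K" for f
    by (rule ex1_chain_weight) (use that abstract_complexD(1)[OF assms] in \<open>simp_all add: realization_def\<close>)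
  show "inj_on sd_map (realization (Sd K))"
  proof (rule inj_onI)
    fix g g' assume "g \<in> realization (Sd K)" "g' \<in> realization (Sd K)" "sd_map g = sd_map g'"
    then show "g = g'"
      using ex1[of "sd_map g"] realization_Sd_iff[OF assms] by metis
  qed
  show "sd_map ` realization (Sd K) = realization K"
  proof
    show "realization K \<subseteq> sd_map ` realization (Sd K)"
    proof
      fix f assume f: "f \<in> realization K"
      then obtain g where "chain_weight g" "sd_map g = f"
        using ex1[OF f] by blast
      with f show "f \<in> sd_map ` realization (Sd K)"
        using realization_Sd_iff[OF assms, of g] by blast
    qed
  qed (use realization_Sd_iff[OF assms] in blast)
qed

lemma continuous_on_sd_map:
  assumes "finite K"
  shows "continuous_on (realization (Sd K)) sd_map"
proof (rule continuous_on_coordinatewise_then_product)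
  fix v
  have "continuous_on (realization (Sd K)) (\<lambda>g. \<Sum>\<sigma>\<in>K. g \<sigma> * barycenter \<sigma> v)"
    by (intro continuous_on_sum continuous_on_mult continuous_on_const
        continuous_on_subset[OF continuous_on_product_coordinates]) auto
  moreover have "sd_map g v = (\<Sum>\<sigma>\<in>K. g \<sigma> * barycenter \<sigma> v)" if "g \<in> realization (Sd K)" for g
    by (rule sd_map_superset) (use that assms in \<open>auto simp: realization_def Sd_def\<close>)
  ultimately show "continuous_on (realization (Sd K)) (\<lambda>g. sd_map g v)"
    by (simp cong: continuous_on_cong)
qed

section \<open>Powers of ordered complexes\<close>

text \<open>Comparability with \<open>x = y\<close> supplies reflexivity on \<open>S\<close>. The
  relation is a parameter so that its converse yields greatest elements.\<close>

lemma finite_chain_has_least: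
  assumes "finite S" "S \<noteq> {}" "\<And>x y. x \<in> S \<Longrightarrow> y \<in> S \<Longrightarrow> le x y \<or> le y x"
    and "\<And>x y z. le x y \<Longrightarrow> le y z \<Longrightarrow> le x z"
  shows "\<exists>m\<in>S. \<forall>x\<in>S. le m x"
  using assms(1-3)
proof (induction S rule: finite_ne_induct)
  case (insert a S)
  then obtain m where m: "m \<in> S" "\<And>x. x \<in> S \<Longrightarrow> le m x"
    by auto
  have "le a a" "le a m \<or> le m a"
    using insert.prems m(1) by blast+
  then show ?case
    using m assms(4) by blast
qed auto

section \<open>Weighted chains of tuples and their coordinates\<close>

lemma power_map_superset:
  assumes "finite A" "{w. f w \<noteq> 0} \<subseteq> A"
  shows "power_map f k v = (\<Sum>w\<in>A. if w k = v then f w else 0)"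
proof -
  have "power_map f k v = (\<Sum>w\<in>{w \<in> A. w k = v}. f w)"
    unfolding power_map_def by (rule sum.mono_neutral_left) (use assms in auto)
  then show ?thesis
    using assms(1) by (simp add: sum.inter_filter)
qed

definition tuple_le :: "'v rel \<Rightarrow> ('n \<Rightarrow> 'v) \<Rightarrow> ('n \<Rightarrow> 'v) \<Rightarrow> bool" where
  "tuple_le r w w' \<longleftrightarrow> (\<forall>k. (w k, w' k) \<in> r)"

lemma tuple_le_trans: "trans r \<Longrightarrow> tuple_le r u v \<Longrightarrow> tuple_le r v w \<Longrightarrow> tuple_le r u w"
  unfolding tuple_le_def by (meson transD)

text \<open>The counterpart of \<open>chain_weight\<close> for powers: the support is a finite chain
  in the coordinatewise order, with the mass and the complex left open.\<close>

definition tuple_weight :: "'v rel \<Rightarrow> (('n \<Rightarrow> 'v) \<Rightarrow> real) \<Rightarrow> bool" where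
  "tuple_weight r f \<longleftrightarrow> (\<forall>w. 0 \<le> f w) \<and> finite {w. f w \<noteq> 0} \<and>
     (\<forall>w w'. f w \<noteq> 0 \<longrightarrow> f w' \<noteq> 0 \<longrightarrow> tuple_le r w w' \<or> tuple_le r w' w)"

lemma tuple_weightD:
  assumes "tuple_weight r f"
  shows "0 \<le> f w" "finite {w. f w \<noteq> 0}"
    "f w \<noteq> 0 \<Longrightarrow> f w' \<noteq> 0 \<Longrightarrow> tuple_le r w w' \<or> tuple_le r w' w"
  using assms unfolding tuple_weight_def by blast+

lemma power_map_ge:
  assumes "tuple_weight r f"
  shows "f w \<le> power_map f k (w k)"
proof (cases "f w = 0")
  case True
  then show ?thesis
    by (simp add: power_map_def tuple_weightD(1)[OF assms] sum_nonneg)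
next
  case False
  have "finite {w'. f w' \<noteq> 0 \<and> w' k = w k}"
    using tuple_weightD(2)[OF assms] by simp
  then show ?thesis
    unfolding power_map_def using False tuple_weightD(1)[OF assms]
    by (intro member_le_sum) simp_all
qed

lemma power_map_nonneg: "tuple_weight r f \<Longrightarrow> 0 \<le> power_map f k v"
  by (simp add: power_map_def tuple_weightD(1) sum_nonneg)

lemma power_map_support:
  assumes "tuple_weight r f"
  shows "{v. power_map f k v \<noteq> 0} = (\<lambda>w. w k) ` {w. f w \<noteq> 0}"
proof (intro equalityI subsetI)
  fix v assume "v \<in> {v. power_map f k v \<noteq> 0}"
  then obtain w where "w \<in> {w. f w \<noteq> 0 \<and> w k = v}"
    unfolding power_map_def using sum.not_neutral_contains_not_neutral by blast
  then show "v \<in> (\<lambda>w. w k) ` {w. f w \<noteq> 0}"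
    by blast
next
  fix v assume "v \<in> (\<lambda>w. w k) ` {w. f w \<noteq> 0}"
  then obtain w where "f w \<noteq> 0" "v = w k"
    by blast
  then show "v \<in> {v. power_map f k v \<noteq> 0}"
    using power_map_ge[OF assms, of w k] tuple_weightD(1)[OF assms, of w] by simp
qed

text \<open>The \<open>k\<close>-th coordinate partitions the support into fibres. All components of
  the image thus have the same mass, which is why \<open>ex1_tuple_weight\<close> assumes a common
  value \<open>m\<close>.\<close>

lemma sum_power_map:
  assumes "tuple_weight r f"
  shows "(\<Sum>v | power_map f k v \<noteq> 0. power_map f k v) = (\<Sum>w | f w \<noteq> 0. f w)"
proof -
  let ?S = "{w. f w \<noteq> 0}"
  have fin: "finite ?S"
    using tuple_weightD(2)[OF assms] .
  have "(\<Sum>v\<in>(\<lambda>w. w k) ` ?S. power_map f k v) = (\<Sum>v\<in>(\<lambda>w. w k) ` ?S. \<Sum>w\<in>{w \<in> ?S. w k = v}. f w)"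
    by (simp add: power_map_def)
  also have "\<dots> = sum f ?S"
    using fin by (rule sum.image_gen[symmetric])
  finally show ?thesis
    by (simp only: power_map_support[OF assms])
qed

lemma power_map_upd:
  assumes "finite {w. f w \<noteq> 0}" "f u = 0"
  shows "power_map (f(u := a)) k v = power_map f k v + (if u k = v then a else 0)"
proof -
  let ?A = "insert u {w. f w \<noteq> 0}"
  have "power_map (f(u := a)) k v = (\<Sum>w\<in>?A. if w k = v then (f(u := a)) w else 0)"
    by (rule power_map_superset) (use assms(1) in auto)
  also have "\<dots> = (if u k = v then a else 0) + (\<Sum>w | f w \<noteq> 0. if w k = v then f w else 0)"
    using assms by (subst sum.insert) (auto intro!: sum.cong)
  also have "(\<Sum>w | f w \<noteq> 0. if w k = v then f w else 0) = power_map f k v"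
    by (rule power_map_superset[symmetric]) (use assms(1) in auto)
  finally show ?thesis
    by (simp only: add.commute)
qed

lemma power_map_comp_perm:
  fixes \<pi> :: "'n::finite \<Rightarrow> 'n"
  assumes "bij \<pi>"
  shows "power_map (f \<circ> (\<lambda>w. w \<circ> \<pi>)) = power_map f \<circ> inv \<pi>"
proof (intro ext)
  fix k v
  have inj: "inj \<pi>" and surj: "surj \<pi>"
    using assms by (auto simp: bij_def)
  have 1: "w \<circ> inv \<pi> \<circ> \<pi> = w" "w \<circ> \<pi> \<circ> inv \<pi> = w" for w
    by (simp_all add: fun_eq_iff inv_f_f[OF inj] surj_f_inv_f[OF surj])
  have "(\<Sum>w | f (w \<circ> \<pi>) \<noteq> 0 \<and> w k = v. f (w \<circ> \<pi>)) = (\<Sum>w | f w \<noteq> 0 \<and> w (inv \<pi> k) = v. f w)"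
    by (rule sum.reindex_bij_witness[where i = "\<lambda>w. w \<circ> inv \<pi>" and j = "\<lambda>w. w \<circ> \<pi>"])
      (simp_all add: 1 surj_f_inv_f[OF surj])
  then show "power_map (f \<circ> (\<lambda>w. w \<circ> \<pi>)) k v = (power_map f \<circ> inv \<pi>) k v"
    by (simp add: power_map_def)
qed

text \<open>
  The bottom tuple of the chain consists of the least vertices \<open>u k\<close> of the supports of the
  \<open>x k\<close>, and its weight is the least of the \<open>x k (u k)\<close>, because the next tuple of the chain
  differs from \<open>u\<close> in some coordinate; now peel it off.
\<close>

lemma ex1_tuple_weight:
  fixes x :: "'n::finite \<Rightarrow> 'v \<Rightarrow> real"
  assumes r: "trans r" "antisym r"
    and "\<And>k. finite {v. x k v \<noteq> 0}" "\<And>k v. 0 \<le> x k v"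
    and "\<And>k u v. x k u \<noteq> 0 \<Longrightarrow> x k v \<noteq> 0 \<Longrightarrow> (u, v) \<in> r \<or> (v, u) \<in> r"
    and "\<And>k. (\<Sum>v | x k v \<noteq> 0. x k v) = m"
  shows "\<exists>!f. tuple_weight r f \<and> power_map f = x"
  using assms(3-)
\<comment> \<open>The mass \<open>m\<close> is generalised because peeling off weight
  \<open>a\<close> lowers it to \<open>m - a\<close> in every coordinate.\<close>
proof (induction "\<Sum>k\<in>UNIV. card {v. x k v \<noteq> 0}" arbitrary: x m rule: less_induct)
  case less
  define S where "S k = {v. x k v \<noteq> 0}" for k
  have finS: "finite (S k)" for k
    using less.prems(1) by (simp add: S_def)
  show ?case
  proof (cases "\<exists>k. S k = {}")
    case True
    \<comment> \<open>One empty support forces the common mass to be 0, and then nonnegativity makes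
      every coordinate vanish.\<close>
    then obtain k0 where "S k0 = {}" ..
    then have "m = 0"
      using less.prems(4)[of k0] by (metis S_def sum.empty)
    then have x0: "x k v = 0" for k v
      using less.prems(4)[of k] sum_nonneg_eq_0_iff[OF less.prems(1)[of k], of "x k"] less.prems(2)[of k]
      by blast
    show ?thesis
    proof (rule ex1I[of _ "\<lambda>_. 0"])
      show "tuple_weight r (\<lambda>_. 0) \<and> power_map (\<lambda>_. 0) = x"
        by (simp add: x0 fun_eq_iff tuple_weight_def power_map_def)
      fix f assume f: "tuple_weight r f \<and> power_map f = x"
      then have "f w \<le> 0" for w
        using power_map_ge[of r f w k0] x0 by simp
      then show "f = (\<lambda>_. 0)"
        using f tuple_weightD(1)[of r f] by (intro ext antisym) auto
    qed
  next
    case False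
    have "\<exists>u\<in>S k. \<forall>v\<in>S k. (u, v) \<in> r" for k
      by (rule finite_chain_has_least)
        (use finS False less.prems(3) transD[OF r(1)] in \<open>auto simp: S_def\<close>)
    then obtain u where u: "\<And>k. u k \<in> S k" "\<And>k v. v \<in> S k \<Longrightarrow> (u k, v) \<in> r"
      by metis
    \<comment> \<open>The most weight that can be taken from \<open>u\<close> in all coordinates at
      once; it exhausts the vertex \<open>u k0\<close> in some coordinate \<open>k0\<close>, so the
      supports shrink.\<close>
    define a where "a = Min (range (\<lambda>k. x k (u k)))"
    have a_le: "a \<le> x k (u k)" for k
      by (simp add: a_def)
    have "a \<in> range (\<lambda>k. x k (u k))"
      unfolding a_def by (intro Min_in) auto
    then obtain k0 where k0: "x k0 (u k0) = a"
      by auto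
    have a_pos: "a > 0"
      using k0 u(1)[of k0] less.prems(2)[of k0 "u k0"] by (auto simp: S_def less_le)
    define x' where "x' k = (x k)(u k := x k (u k) - a)" for k
    have supp': "{v. x' k v \<noteq> 0} \<subseteq> S k" for k
      using u(1)[of k] by (auto simp: x'_def S_def)
    have "\<exists>!f. tuple_weight r f \<and> power_map f = x'"
    proof (rule less.hyps)
      have "u k0 \<notin> {v. x' k0 v \<noteq> 0}"
        by (simp add: x'_def k0)
      then have "{v. x' k0 v \<noteq> 0} \<subset> S k0"
        using supp'[of k0] u(1)[of k0] by blast
      then have "card {v. x' k0 v \<noteq> 0} < card (S k0)"
        by (simp add: finS psubset_card_mono)
      moreover have "card {v. x' k v \<noteq> 0} \<le> card (S k)" for k
        by (simp add: finS supp' card_mono)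
      ultimately show "(\<Sum>k\<in>UNIV. card {v. x' k v \<noteq> 0}) < (\<Sum>k\<in>UNIV. card {v. x k v \<noteq> 0})"
        unfolding S_def by (intro sum_strict_mono_ex1) auto
      show "finite {v. x' k v \<noteq> 0}" for k
        using supp' finS finite_subset by blast
      show "0 \<le> x' k v" for k v
        using a_le[of k] less.prems(2)[of k v] by (simp add: x'_def)
      show "(v, w) \<in> r \<or> (w, v) \<in> r" if "x' k v \<noteq> 0" "x' k w \<noteq> 0" for k v w
        using that supp'[of k] less.prems(3)[of k v w] by (auto simp: S_def)
      show "(\<Sum>v | x' k v \<noteq> 0. x' k v) = m - a" for k
      proof -
        have "(\<Sum>v | x' k v \<noteq> 0. x' k v) = sum (x' k) (S k)"
          by (rule sum_support_superset[OF finS supp'])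
        also have "\<dots> = sum (x k) (S k) - a"
          using sum.remove[of "S k" "u k" "x' k", OF finS u(1)] sum.remove[of "S k" "u k" "x k", OF finS u(1)]
          by (simp add: x'_def)
        finally show ?thesis
          using less.prems(4)[of k] by (simp add: S_def)
      qed
    qed
    then obtain f' where f': "tuple_weight r f'" "power_map f' = x'"
      and uniq: "\<And>f. tuple_weight r f \<Longrightarrow> power_map f = x' \<Longrightarrow> f = f'"
      by blast
    have f'_supp: "w k \<in> S k" "w k0 \<noteq> u k0" if "f' w \<noteq> 0" for w k
    proof -
      have *: "x' k (w k) \<noteq> 0" for k
        using that power_map_support[OF f'(1), of k] f'(2) by blast
      show "w k \<in> S k"
        using *[of k] supp' by blast
      show "w k0 \<noteq> u k0"
        using *[of k0] by (auto simp: x'_def k0)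
    qed
    have f'u: "f' u = 0"
      using f'_supp(2) by blast
    have u_le: "tuple_le r u w" if "f' w \<noteq> 0" for w
      using f'_supp(1)[OF that] u(2) by (simp add: tuple_le_def)
    have u_refl: "tuple_le r u u"
      using u by (simp add: tuple_le_def)
    have x_eq: "x k v = x' k v + (if u k = v then a else 0)" for k v
      by (simp add: x'_def)
    show ?thesis
    proof (rule ex1I[of _ "f'(u := a)"], intro conjI)
      have eq: "{w. (f'(u := a)) w \<noteq> 0} = insert u {w. f' w \<noteq> 0}"
        using a_pos by auto
      show "tuple_weight r (f'(u := a))"
        unfolding tuple_weight_def eq
        using tuple_weightD[OF f'(1)] a_pos u_le u_refl by auto
      show "power_map (f'(u := a)) = x"
        by (intro ext) (simp add: power_map_upd[OF tuple_weightD(2)[OF f'(1)] f'u] f'(2) x_eq)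
      fix f assume f: "tuple_weight r f \<and> power_map f = x"
      then have f_supp: "S k = (\<lambda>w. w k) ` {w. f w \<noteq> 0}" for k
        using power_map_support[of r f k] by (simp add: S_def)
      have tw: "tuple_weight r f"
        using f by blast
      have least: "\<exists>w\<in>T. \<forall>w'\<in>T. tuple_le r w w'" if "T \<subseteq> {w. f w \<noteq> 0}" "T \<noteq> {}" for T
        by (rule finite_chain_has_least)
          (use that finite_subset[OF that(1)] tuple_weightD(2,3)[OF tw] tuple_le_trans[OF r(1)] in blast)+
      have "{w. f w \<noteq> 0} \<noteq> {}"
        using f_supp[of k0] u(1)[of k0] by blast
      then obtain w0 where w0: "f w0 \<noteq> 0" "\<And>w. f w \<noteq> 0 \<Longrightarrow> tuple_le r w0 w"
        using least[of "{w. f w \<noteq> 0}"] by blast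
      have "w0 = u"
      proof
        fix k
        have "w0 k \<in> S k"
          using f_supp[of k] w0(1) by blast
        then have 1: "(u k, w0 k) \<in> r"
          using u(2) by blast
        obtain w where "f w \<noteq> 0" "w k = u k"
          using f_supp[of k] u(1)[of k] by (metis (mono_tags, lifting) imageE mem_Collect_eq)
        then have "(w0 k, u k) \<in> r"
          using w0(2) by (metis tuple_le_def)
        then show "w0 k = u k"
          using 1 r(2) by (simp add: antisymD)
      qed
      \<comment> \<open>Let \<open>w1\<close> be the second tuple of the chain and \<open>k\<close>
        a coordinate where it differs from \<open>u\<close>. A later tuple agreeing with
        \<open>u\<close> at \<open>k\<close> would squeeze \<open>w1 k\<close> to
        \<open>u k\<close>, so this coordinate separates \<open>u\<close> from all others.\<close>
      have "\<exists>k. \<forall>w. f w \<noteq> 0 \<and> w \<noteq> u \<longrightarrow> w k \<noteq> u k"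
      proof (cases "\<exists>w. f w \<noteq> 0 \<and> w \<noteq> u")
        case True
        then obtain w1 where w1: "f w1 \<noteq> 0" "w1 \<noteq> u" "\<And>w. f w \<noteq> 0 \<Longrightarrow> w \<noteq> u \<Longrightarrow> tuple_le r w1 w"
          using least[of "{w. f w \<noteq> 0} - {u}"] by blast
        then obtain k where k: "w1 k \<noteq> u k"
          by blast
        have "w k \<noteq> u k" if "f w \<noteq> 0" "w \<noteq> u" for w
        proof
          assume "w k = u k"
          then have "(w1 k, u k) \<in> r" "(u k, w1 k) \<in> r"
            using w1(3)[OF that] w0(2)[OF w1(1)] \<open>w0 = u\<close> by (metis tuple_le_def)+
          then show False
            using k r(2) by (meson antisymD)
        qed
        then show ?thesis
          by blast
      qed blast
      then obtain k1 where k1: "\<And>w. f w \<noteq> 0 \<Longrightarrow> w \<noteq> u \<Longrightarrow> w k1 \<noteq> u k1"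
        by blast
      have "x k1 (u k1) = f u"
      proof -
        have "{w. f w \<noteq> 0 \<and> w k1 = u k1} = {u}"
          using k1 w0(1) \<open>w0 = u\<close> by blast
        then have "power_map f k1 (u k1) = f u"
          by (simp add: power_map_def)
        then show ?thesis
          using f by simp
      qed
      \<comment> \<open>At \<open>k1\<close> the tuple \<open>u\<close> is alone in its fibre, so
        \<open>f u = x k1 (u k1)\<close> is at least the minimum \<open>a\<close>; at
        \<open>k0\<close> it is at most \<open>x k0 (u k0) = a\<close>.\<close>
      then have fu: "f u = a"
        using a_le[of k1] power_map_ge[OF tw, of u k0] f k0 by simp
      define h where "h = f(u := 0)"
      have hsub: "{w. h w \<noteq> 0} \<subseteq> {w. f w \<noteq> 0}"
        by (auto simp: h_def)
      have h: "f = h(u := a)" "h u = 0"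
        using fu by (auto simp: h_def)
      have twh: "tuple_weight r h"
        unfolding tuple_weight_def
        using tuple_weightD[OF tw] finite_subset[OF hsub] by (auto simp: h_def)
      have "power_map h k v = x' k v" for k v
        using power_map_upd[OF tuple_weightD(2)[OF twh] h(2), of a k v] x_eq[of k v] h(1) f by simp
      then have "h = f'"
        using uniq[OF twh] by blast
      then show "f = f'(u := a)"
        using h(1) by simp
    qed
  qed
qed

text \<open>Produces the injective enumeration that \<open>power_complex\<close> asks for, by
  putting the greatest element last.\<close>

lemma finite_chain_enumeration:
  assumes "finite S" "S \<noteq> {}" "\<And>x y. x \<in> S \<Longrightarrow> y \<in> S \<Longrightarrow> le x y \<or> le y x"
    and trans: "\<And>x y z. le x y \<Longrightarrow> le y z \<Longrightarrow> le x z"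
  shows "\<exists>w q. inj_on w {..q::nat} \<and> w ` {..q} = S \<and> (\<forall>j<q. le (w j) (w (Suc j)))"
  using assms(1-3)
proof (induction "card S" arbitrary: S rule: less_induct)
  case less
  obtain m where m: "m \<in> S" "\<And>x. x \<in> S \<Longrightarrow> le x m"
    using finite_chain_has_least[of S "\<lambda>x y. le y x"] less.prems trans by blast
  show ?case
  proof (cases "S = {m}")
    case True
    then show ?thesis
      by (intro exI[of _ "\<lambda>_. m"] exI[of _ 0]) auto
  next
    case False
    have "card (S - {m}) < card S"
      by (rule card_Diff1_less) (use less.prems(1) m(1) in auto)
    then obtain w q where w: "inj_on w {..q}" "w ` {..q} = S - {m}" "\<forall>j<q. le (w j) (w (Suc j))"
      using less.hyps[of "S - {m}"] less.prems False m(1) by blast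
    define w' where "w' = w(Suc q := m)"
    have w'_eq: "w' j = w j" if "j \<le> q" for j
      using that by (simp add: w'_def)
    have w'_img: "w' ` {..q} = S - {m}"
      using w(2) w'_eq by (metis (no_types, lifting) atMost_iff image_cong)
    have "w' ` {..Suc q} = S"
    proof -
      have "w' ` {..Suc q} = insert (w' (Suc q)) (w' ` {..q})"
        by (simp add: atMost_Suc)
      also have "\<dots> = insert m (S - {m})"
        unfolding w'_img by (simp add: w'_def)
      finally show ?thesis
        by (simp only: insert_Diff[OF m(1)])
    qed
    moreover have "inj_on w' {..Suc q}"
      using w(1) w'_img inj_on_cong[of "{..q}" w' w] w'_eq
      by (simp add: atMost_Suc) (simp add: w'_def)
    moreover have "le (w' j) (w' (Suc j))" if "j < Suc q" for j
    proof (cases "j = q")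
      case True
      then show ?thesis
        using w(2) m(2)[of "w q"] by (auto simp: w'_def)
    next
      case False
      then show ?thesis
        using that w(3) by (simp add: w'_eq)
    qed
    ultimately show ?thesis
      by blast
  qed
qed

lemma vimage_perm:
  fixes \<pi> :: "'n \<Rightarrow> 'n" and S :: "('n \<Rightarrow> 'v) set"
  assumes "bij \<pi>"
  shows "(\<lambda>w. w \<circ> \<pi>) -` S = (\<lambda>w. w \<circ> inv \<pi>) ` S"
proof -
  have 1: "w \<circ> \<pi> \<circ> inv \<pi> = w" "w \<circ> inv \<pi> \<circ> \<pi> = w" for w :: "'n \<Rightarrow> 'v"
    using assms by (simp_all add: fun_eq_iff bij_is_inj bij_is_surj surj_f_inv_f)
  show ?thesis
  proof (intro equalityI subsetI)
    fix w assume "w \<in> (\<lambda>w. w \<circ> \<pi>) -` S"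
    then show "w \<in> (\<lambda>w. w \<circ> inv \<pi>) ` S"
      by (intro image_eqI[of _ _ "w \<circ> \<pi>"]) (simp_all only: 1 vimage_eq)
  next
    fix w assume "w \<in> (\<lambda>w. w \<circ> inv \<pi>) ` S"
    then obtain w' where "w = w' \<circ> inv \<pi>" "w' \<in> S"
      by blast
    then show "w \<in> (\<lambda>w. w \<circ> \<pi>) -` S"
      by (simp only: 1 vimage_eq)
  qed
qed

lemma barycenter_in_realization:
  assumes "finite S" "S \<noteq> {}" "S \<in> K"
  shows "barycenter S \<in> realization K"
proof -
  have "{v. barycenter S v \<noteq> 0} = S"
    using assms(1) by (auto simp: barycenter_def)
  then show ?thesis
    using assms unfolding realization_def by (simp add: barycenter_def)
qed

section \<open>The power of a fixed ordered complex and its realization\<close>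

locale ordered_complex_power =
  fixes X :: "'v set set" and r :: "'v rel" and P :: "('n::finite \<Rightarrow> 'v) set set"
  assumes ordered: "ordered_complex X r"
  defines "P \<equiv> power_complex X r"
begin

lemma complex: "abstract_complex X"
  and order: "partial_order_on (\<Union>X) r"
  using ordered by (auto simp: ordered_complex_def)

lemma trans: "trans r"
  and antisym: "antisym r"
  and refl: "v \<in> \<Union>X \<Longrightarrow> (v, v) \<in> r"
  using order by (auto simp: partial_order_on_def preorder_on_def refl_on_def)

lemma total:
  assumes "\<sigma> \<in> X" "u \<in> \<sigma>" "v \<in> \<sigma>"
  shows "(u, v) \<in> r \<or> (v, u) \<in> r"
proof (cases "u = v")
  case False
  then show ?thesis
    using ordered assms by (auto simp: ordered_complex_def total_on_def)
qed (use refl[of u] assms in blast)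

text \<open>Trades the enumeration of a simplex for pairwise comparability, the form used in
  \<open>tuple_weight\<close>. Transitivity extends the comparison of neighbours to all
  pairs.\<close>

lemma power_complex_iff:
  "S \<in> P \<longleftrightarrow> finite S \<and> S \<noteq> {} \<and> (\<forall>k. (\<lambda>w. w k) ` S \<in> X) \<and>
     (\<forall>w\<in>S. \<forall>w'\<in>S. tuple_le r w w' \<or> tuple_le r w' w)"
proof (intro iffI conjI allI ballI; (elim conjE)?)
  assume "S \<in> P"
  then obtain w q where S: "S = w ` {..q}"
    and w: "\<And>k. \<exists>\<sigma>\<in>X. \<forall>j\<le>q. w j k \<in> \<sigma>" "\<And>k j. j < q \<Longrightarrow> (w j k, w (Suc j) k) \<in> r"
    unfolding P_def power_complex_def by blast
  show "finite S" "S \<noteq> {}"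
    by (auto simp: S)
  show "(\<lambda>w. w k) ` S \<in> X" for k
  proof -
    obtain \<sigma> where \<sigma>: "\<sigma> \<in> X" "\<forall>j\<le>q. w j k \<in> \<sigma>"
      using w(1) by blast
    show ?thesis
      by (rule abstract_complexD(3)[OF complex \<sigma>(1)]) (use \<sigma>(2) in \<open>auto simp: S\<close>)
  qed
  have le: "tuple_le r (w i) (w j)" if "i \<le> j" "j \<le> q" for i j
    using that
  proof (induction j rule: dec_induct)
    case base
    show ?case
      unfolding tuple_le_def using refl w(1) base by (meson UnionI)
  next
    case (step j)
    have "tuple_le r (w j) (w (Suc j))"
      using w(2) step.prems by (simp add: tuple_le_def)
    then show ?case
      using step tuple_le_trans[OF trans] by (meson Suc_leD)
  qed
  show "tuple_le r x y \<or> tuple_le r y x" if xy: "x \<in> S" "y \<in> S" for x y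
  proof -
    obtain i j where "x = w i" "y = w j" "i \<le> q" "j \<le> q"
      using xy unfolding S by blast
    then show ?thesis
      using le[of i j] le[of j i] by (cases "i \<le> j") auto
  qed
next
  assume S: "finite S" "S \<noteq> {}" "\<forall>k. (\<lambda>w. w k) ` S \<in> X"
    "\<forall>w\<in>S. \<forall>w'\<in>S. tuple_le r w w' \<or> tuple_le r w' w"
  obtain w q where w: "inj_on w {..q::nat}" "w ` {..q} = S" "\<forall>j<q. tuple_le r (w j) (w (Suc j))"
    using finite_chain_enumeration[of S "tuple_le r"] S tuple_le_trans[OF trans] by blast
  have "\<exists>\<sigma>\<in>X. \<forall>j\<le>q. w j k \<in> \<sigma>" for k
    using S(3) w(2) by (intro bexI[of _ "(\<lambda>w. w k) ` S"]) auto
  then show "S \<in> P"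
    using w unfolding P_def power_complex_def tuple_le_def by blast
qed

lemma power_complexD:
  assumes "S \<in> P"
  shows "finite S" "S \<noteq> {}" "(\<lambda>w. w k) ` S \<in> X"
    "w \<in> S \<Longrightarrow> w' \<in> S \<Longrightarrow> tuple_le r w w' \<or> tuple_le r w' w"
  using iffD1[OF power_complex_iff assms] by simp_all

lemma abstract_complex_power: "abstract_complex P"
  unfolding abstract_complex_def
proof (intro conjI ballI allI impI; (elim conjE)?)
  fix S T assume S: "S \<in> P" and T: "T \<subseteq> S" "T \<noteq> {}"
  have "(\<lambda>w. w k) ` T \<in> X" for k
  proof -
    have "(\<lambda>w. w k) ` S \<in> X"
      using power_complexD(3)[OF S] .
    then show ?thesis
      by (rule abstract_complexD(3)[OF complex]) (use T in auto)
  qed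
  then show "T \<in> P"
    using T finite_subset[OF T(1)] power_complexD(1,4)[OF S] unfolding power_complex_iff by blast
qed (use power_complexD(1,2) in blast)+

lemma finite_power_complex:
  assumes "finite X"
  shows "finite P"
proof -
  let ?V = "\<Pi>\<^sub>E k\<in>(UNIV :: 'n set). \<Union>X"
  have "finite ?V"
    by (intro finite_PiE finite_vertices complex assms) simp
  moreover have "P \<subseteq> Pow ?V"
  proof (intro subsetI PowI)
    fix S w assume "S \<in> P" "w \<in> S"
    then have "(\<lambda>w. w k) ` S \<in> X" "w k \<in> (\<lambda>w. w k) ` S" for k
      using power_complexD(3) by blast+
    then show "w \<in> ?V"
      by (metis PiE_UNIV_domain UNIV_I Pi_I UnionI)
  qed
  ultimately show ?thesis
    using finite_subset by blast
qed

text \<open>By \<open>power_map_support\<close> the coordinate projections of the support are the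
  supports of the components, so membership in \<open>P\<close> can be tested on the image point
  once comparability is known.\<close>

lemma realization_power_iff:
  "f \<in> realization P \<longleftrightarrow> tuple_weight r f \<and> power_map f \<in> power_space (realization X)"
proof
  assume f: "f \<in> realization P"
  define S where "S = {w. f w \<noteq> 0}"
  have fS: "S \<in> P" "\<And>w. 0 \<le> f w" "sum f S = 1"
    using f by (auto simp: realization_def S_def)
  note S = power_complexD[OF fS(1)]
  have tw: "tuple_weight r f"
    using S(1,4) fS(2) unfolding S_def tuple_weight_def by blast
  moreover have "power_map f k \<in> realization X" for k
    using power_map_nonneg[OF tw] S(3)[of k] fS(3) sum_power_map[OF tw, of k]
    unfolding realization_def mem_Collect_eq power_map_support[OF tw] S_def by simp
  ultimately show "tuple_weight r f \<and> power_map f \<in> power_space (realization X)"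
    by (simp add: power_space_def)
next
  assume f: "tuple_weight r f \<and> power_map f \<in> power_space (realization X)"
  then have tw: "tuple_weight r f" and x: "power_map f k \<in> realization X" for k
    by (auto simp: power_space_def)
  define S where "S = {w. f w \<noteq> 0}"
  have "(\<lambda>w. w k) ` S \<in> X" for k
    using x[of k] power_map_support[OF tw, of k] unfolding realization_def S_def by simp
  moreover from this have "S \<noteq> {}"
    using abstract_complexD(2)[OF complex] by blast
  ultimately have "S \<in> P"
    unfolding power_complex_iff using tuple_weightD[OF tw] unfolding S_def by blast
  \<comment> \<open>Every coordinate carries the whole mass; \<open>undefined\<close> merely names
    one.\<close>
  moreover have "sum f S = 1"
    using x[of undefined] sum_power_map[OF tw, of undefined] unfolding realization_def S_def by simp
  ultimately show "f \<in> realization P"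
    using tuple_weightD(1)[OF tw] by (simp add: realization_def S_def)
qed

lemma bij_betw_power_map:
  "bij_betw power_map (realization P) (power_space (realization X))"
proof (rule bij_betw_imageI)
  have ex1: "\<exists>!f. tuple_weight r f \<and> power_map f = x" if x: "x \<in> power_space (realization X)" for x
  proof (rule ex1_tuple_weight[OF trans antisym])
    have *: "{v. x k v \<noteq> 0} \<in> X" "0 \<le> x k v" "(\<Sum>v | x k v \<noteq> 0. x k v) = 1" for k v
      using x by (auto simp: power_space_def realization_def)
    show "finite {v. x k v \<noteq> 0}" for k
      using abstract_complexD(1)[OF complex *(1)] .
    show "(u, v) \<in> r \<or> (v, u) \<in> r" if "x k u \<noteq> 0" "x k v \<noteq> 0" for k u v
      using total[OF *(1)] that by blast
  qed (use x in \<open>simp_all add: power_space_def realization_def\<close>)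
  show "inj_on power_map (realization P)"
  proof (rule inj_onI)
    fix f f' assume "f \<in> realization P" "f' \<in> realization P" "power_map f = power_map f'"
    then show "f = f'"
      using ex1[of "power_map f"] realization_power_iff by metis
  qed
  show "power_map ` realization P = power_space (realization X)"
  proof
    show "power_space (realization X) \<subseteq> power_map ` realization P"
    proof
      fix x :: "'n \<Rightarrow> 'v \<Rightarrow> real" assume x: "x \<in> power_space (realization X)"
      then obtain f where "tuple_weight r f" "power_map f = x"
        using ex1[OF x] by blast
      with x show "x \<in> power_map ` realization P"
        using realization_power_iff[of f] by blast
    qed
  qed (use realization_power_iff in blast)
qed

lemma continuous_on_power_map:
  assumes "finite X"
  shows "continuous_on (realization P) power_map"
proof (intro continuous_on_coordinatewise_then_product)
  fix k v
  have fin: "finite (\<Union>P)"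
    by (rule finite_vertices[OF abstract_complex_power finite_power_complex[OF assms]])
  have "continuous_on (realization P) (\<lambda>f. \<Sum>w\<in>\<Union>P. if w k = v then f w else 0)"
  proof (rule continuous_on_sum)
    fix w :: "'n \<Rightarrow> 'v"
    show "continuous_on (realization P) (\<lambda>f. if w k = v then f w else 0)"
      by (cases "w k = v") (auto intro: continuous_on_subset[OF continuous_on_product_coordinates])
  qed
  moreover have "power_map f k v = (\<Sum>w\<in>\<Union>P. if w k = v then f w else 0)" if "f \<in> realization P" for f
    by (rule power_map_superset[OF fin]) (use that in \<open>auto simp: realization_def\<close>)
  ultimately show "continuous_on (realization P) (\<lambda>f. power_map f k v)"
    by (simp cong: continuous_on_cong)
qed

lemma power_complex_perm:
  assumes "bij \<pi>" "S \<in> P"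
  shows "(\<lambda>w. w \<circ> \<pi>) -` S \<in> P"
proof -
  note S = power_complexD[OF assms(2)]
  have "(\<lambda>w. w k) ` (\<lambda>w. w \<circ> inv \<pi>) ` S \<in> X" for k
    using S(3)[of "inv \<pi> k"] by (simp add: image_image)
  moreover have "tuple_le r (w \<circ> inv \<pi>) (w' \<circ> inv \<pi>)" if "tuple_le r w w'" for w w'
    using that by (simp add: tuple_le_def)
  then have "\<forall>w\<in>(\<lambda>w. w \<circ> inv \<pi>) ` S. \<forall>w'\<in>(\<lambda>w. w \<circ> inv \<pi>) ` S. tuple_le r w w' \<or> tuple_le r w' w"
    using S(4) unfolding ball_simps by blast
  ultimately show ?thesis
    unfolding vimage_perm[OF assms(1)] power_complex_iff using S(1,2) by simp
qed

text \<open>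
  If the coordinates \<open>i\<close> and \<open>j\<close> of the image agree, then swapping them fixes \<open>f\<close>, as
  \<open>power_map\<close> is injective. So every \<open>w\<close> in the support is comparable with its own swap, which
  forces \<open>w i = w j\<close>.
\<close>

lemma power_map_coords_eq_iff:
  assumes f: "f \<in> realization P"
  shows "power_map f i = power_map f j \<longleftrightarrow> (\<forall>w. f w \<noteq> 0 \<longrightarrow> w i = w j)"
proof (intro iffI allI impI)
  fix w assume eq: "power_map f i = power_map f j" and w: "f w \<noteq> 0"
  define \<pi> where "\<pi> = Transposition.transpose i j"
  define f' where "f' = f \<circ> (\<lambda>w. w \<circ> \<pi>)"
  have \<pi>: "bij \<pi>" "inv \<pi> = \<pi>" "\<pi> i = j" "\<pi> j = i"
    by (simp_all add: \<pi>_def)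
  have bij: "bij (\<lambda>w :: 'n \<Rightarrow> 'v. w \<circ> \<pi>)"
    by (rule involuntory_imp_bij) (simp add: fun_eq_iff \<pi>_def)
  have "f' \<in> realization P"
    unfolding f'_def by (rule realization_comp_bij[OF f bij power_complex_perm[OF \<pi>(1)]])
  moreover have "power_map f' = power_map f"
  proof
    fix k
    show "power_map f' k = power_map f k"
      unfolding f'_def power_map_comp_perm[OF \<pi>(1)] \<pi>(2)
      using eq by (simp add: \<pi>_def Transposition.transpose_def)
  qed
  ultimately have "f' = f"
    using bij_betw_power_map f by (auto simp: bij_betw_def inj_on_def)
  then have "f (w \<circ> \<pi>) \<noteq> 0"
    using w by (metis comp_apply f'_def)
  moreover have "tuple_weight r f"
    using f realization_power_iff by blast
  ultimately have "tuple_le r w (w \<circ> \<pi>) \<or> tuple_le r (w \<circ> \<pi>) w"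
    using w tuple_weightD(3) by blast
  \<comment> \<open>Coordinates \<open>i\<close> and \<open>j\<close> of a tuple and its swap are
    compared in opposite senses, so either alternative gives both relations.\<close>
  then have "(w i, w j) \<in> r" "(w j, w i) \<in> r"
    unfolding tuple_le_def using \<pi>(3,4) by (metis comp_apply)+
  then show "w i = w j"
    using antisym by (simp add: antisymD)
next
  assume "\<forall>w. f w \<noteq> 0 \<longrightarrow> w i = w j"
  then have "{w. f w \<noteq> 0 \<and> w i = v} = {w. f w \<noteq> 0 \<and> w j = v}" for v
    by auto
  then show "power_map f i = power_map f j"
    by (simp add: power_map_def)
qed

section \<open>Diagonal subcomplexes\<close>

lemma power_map_in_fat_diagonal_iff:
  assumes "f \<in> realization P"
  shows "power_map f \<in> fat_diagonal m (realization X) \<longleftrightarrow>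
    (\<exists>I. card I = m \<and> (\<forall>i\<in>I. \<forall>j\<in>I. \<forall>w. f w \<noteq> 0 \<longrightarrow> w i = w j))"
  using assms realization_power_iff power_map_coords_eq_iff[OF assms]
  by (simp add: fat_diagonal_def)

text \<open>The definition lets \<open>I\<close> vary with the point of the closed simplex. The
  barycenter has full support, so the \<open>I\<close> that serves it serves every vertex of
  \<open>S\<close>, hence every point.\<close>

lemma diagonal_complex_iff:
  "S \<in> diagonal_complex m X r \<longleftrightarrow>
     S \<in> P \<and> (\<exists>I. card I = m \<and> (\<forall>i\<in>I. \<forall>j\<in>I. \<forall>w\<in>S. w i = w j))"
proof (cases "S \<in> P")
  case True
  have sub: "closed_simplex S \<subseteq> realization P"
    using abstract_complexD(3)[OF abstract_complex_power True]
    unfolding closed_simplex_def realization_def by blast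
  have S: "finite S" "S \<noteq> {}"
    using abstract_complexD[OF abstract_complex_power True] by blast+
  have "barycenter S \<in> closed_simplex S"
    unfolding closed_simplex_def by (rule barycenter_in_realization) (use S in auto)
  moreover have "barycenter S w \<noteq> 0 \<longleftrightarrow> w \<in> S" for w
    using S by (simp add: barycenter_def)
  ultimately have "power_map ` closed_simplex S \<subseteq> fat_diagonal m (realization X) \<longleftrightarrow>
      (\<exists>I. card I = m \<and> (\<forall>i\<in>I. \<forall>j\<in>I. \<forall>w\<in>S. w i = w j))" (is "?L \<longleftrightarrow> ?R")
  proof (intro iffI)
    assume ?L
    then have "power_map (barycenter S) \<in> fat_diagonal m (realization X)"
      using \<open>barycenter S \<in> closed_simplex S\<close> by blast
    then show ?R
      using power_map_in_fat_diagonal_iff[of "barycenter S" m] sub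
        \<open>barycenter S \<in> closed_simplex S\<close> \<open>\<And>w. barycenter S w \<noteq> 0 \<longleftrightarrow> w \<in> S\<close>
      by blast
  next
    assume R: ?R
    show ?L
    proof (intro image_subsetI)
      fix f assume f: "f \<in> closed_simplex S"
      then have "w \<in> S" if "f w \<noteq> 0" for w
        using that by (auto simp: closed_simplex_def realization_def)
      then show "power_map f \<in> fat_diagonal m (realization X)"
        using power_map_in_fat_diagonal_iff[of f m] sub f R by blast
    qed
  qed
  with True show ?thesis
    unfolding diagonal_complex_def P_def by blast
qed (simp add: diagonal_complex_def P_def)

lemma abstract_complex_diagonal: "abstract_complex (diagonal_complex m X r :: ('n \<Rightarrow> 'v) set set)"
  unfolding abstract_complex_def
proof (intro conjI ballI allI impI; (elim conjE)?)
  fix S T :: "('n \<Rightarrow> 'v) set" assume "S \<in> diagonal_complex m X r" "T \<subseteq> S" "T \<noteq> {}"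
  then show "T \<in> diagonal_complex m X r"
    using abstract_complexD(3)[OF abstract_complex_power] unfolding diagonal_complex_iff by blast
qed (use diagonal_complex_iff abstract_complexD(1,2)[OF abstract_complex_power] in blast)+

lemma diagonal_complex_subset: "(diagonal_complex m X r :: ('n \<Rightarrow> 'v) set set) \<subseteq> P"
  using diagonal_complex_iff by blast

text \<open>Lying in the fat diagonal depends only on the support, by the same index-set condition
  that characterises the simplices of the diagonal.\<close>

lemma realization_diagonal_iff:
  assumes "f \<in> realization P"
  shows "f \<in> realization (diagonal_complex m X r) \<longleftrightarrow>
    power_map f \<in> fat_diagonal m (realization X)"
proof -
  have "{w. f w \<noteq> 0} \<in> P"
    using assms by (simp add: realization_def)
  then have "{w. f w \<noteq> 0} \<in> diagonal_complex m X r \<longleftrightarrow>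
      power_map f \<in> fat_diagonal m (realization X)"
    unfolding diagonal_complex_iff power_map_in_fat_diagonal_iff[OF assms] by simp
  then show ?thesis
    using assms by (simp add: realization_def)
qed

lemma diagonal_complex_perm:
  fixes \<pi> :: "'n \<Rightarrow> 'n"
  assumes "bij \<pi>" "S \<in> diagonal_complex m X r"
  shows "(\<lambda>w. w \<circ> \<pi>) -` S \<in> (diagonal_complex m X r :: ('n \<Rightarrow> 'v) set set)"
proof -
  obtain I where I: "card I = m" "\<And>i j w. i \<in> I \<Longrightarrow> j \<in> I \<Longrightarrow> w \<in> S \<Longrightarrow> w i = w j"
    using assms(2) unfolding diagonal_complex_iff by blast
  \<comment> \<open>Permuting coordinates carries the index set of coincidences to its
    image.\<close>
  have "card (\<pi> ` I) = m"
    using I(1) card_image[OF inj_on_subset[OF bij_is_inj[OF assms(1)]], of I] by simp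
  moreover have "w i = w j" if "i \<in> \<pi> ` I" "j \<in> \<pi> ` I" "w \<circ> \<pi> \<in> S" for i j w
    using that I(2)[of _ _ "w \<circ> \<pi>"] by auto
  ultimately show ?thesis
    unfolding diagonal_complex_iff using assms power_complex_perm diagonal_complex_iff by blast
qed

end

section \<open>Deformation retractions\<close>

text \<open>Conjugation by \<open>h\<close>. Invariance of \<open>U\<close> ensures that
  \<open>g\<close> undoes \<open>h\<close> at translated points as well.\<close>

lemma equivariant_deformation_retraction_homeomorphic_image:
  fixes h :: "'a::topological_space \<Rightarrow> 'b::topological_space"
  assumes h: "homeomorphism R Y h g" and U: "U \<subseteq> R"
    and edr: "equivariant_deformation_retraction G \<alpha> U B \<rho>"
    and U_inv: "\<And>\<pi> x. \<pi> \<in> G \<Longrightarrow> x \<in> U \<Longrightarrow> \<alpha> \<pi> x \<in> U"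
    and equi: "\<And>\<pi> x. \<pi> \<in> G \<Longrightarrow> h (\<alpha> \<pi> x) = act \<pi> (h x)"
  shows "equivariant_deformation_retraction G act (h ` U) (h ` B) (h \<circ> \<rho> \<circ> g)"
proof -
  let ?P = "\<lambda>f. (\<forall>x\<in>B. f x = x) \<and> (\<forall>\<pi>\<in>G. \<forall>x\<in>U. f (\<alpha> \<pi> x) = \<alpha> \<pi> (f x))"
  let ?Q = "\<lambda>f. (\<forall>y\<in>h ` B. f y = y) \<and> (\<forall>\<pi>\<in>G. \<forall>y\<in>h ` U. f (act \<pi> y) = act \<pi> (f y))"
  have ret: "B \<subseteq> U" "continuous_on U \<rho>" "\<rho> \<in> U \<rightarrow> B" "\<And>x. x \<in> B \<Longrightarrow> \<rho> x = x"
    and hom: "homotopic_with_canon ?P U U id \<rho>"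
    using edr by (auto simp: equivariant_deformation_retraction_def retraction_def)
  have gh: "g (h x) = x" if "x \<in> U" for x
    using homeomorphism_apply1[OF h] that U by blast
  have cont_h: "continuous_on U h"
    using homeomorphism_cont1[OF h] U continuous_on_subset by blast
  have "h ` U \<subseteq> Y"
    using homeomorphism_image1[OF h] U by blast
  then have cont_g: "continuous_on (h ` U) g"
    using homeomorphism_cont2[OF h] continuous_on_subset by blast
  have g_into: "g ` h ` U = U"
    using gh by (force simp: image_iff)
  have Q: "?Q (h \<circ> f \<circ> g)" if "?P f" for f
  proof (intro conjI ballI)
    fix y assume "y \<in> h ` B"
    then show "(h \<circ> f \<circ> g) y = y"
      using that gh ret(1) by auto
  next
    fix \<pi> y assume \<pi>: "\<pi> \<in> G" and "y \<in> h ` U"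
    then obtain x where x: "x \<in> U" "y = h x"
      by blast
    have "g (act \<pi> y) = \<alpha> \<pi> x"
      using gh[OF U_inv[OF \<pi> x(1)]] equi[OF \<pi>] x(2) by simp
    then show "(h \<circ> f \<circ> g) (act \<pi> y) = act \<pi> ((h \<circ> f \<circ> g) y)"
      using that \<pi> x gh equi[OF \<pi>] by simp
  qed
  have "homotopic_with_canon ?Q (h ` U) (h ` U) (h \<circ> id \<circ> g) (h \<circ> \<rho> \<circ> g)"
  proof (rule homotopic_with_compose_continuous_map_right)
    show "homotopic_with_canon (\<lambda>f. ?Q (f \<circ> g)) U (h ` U) (h \<circ> id) (h \<circ> \<rho>)"
      by (rule homotopic_with_compose_continuous_map_left[OF hom])
        (use cont_h Q in \<open>auto simp: o_assoc\<close>)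
    show "continuous_map (top_of_set (h ` U)) (top_of_set U) g"
      using cont_g g_into by auto
  qed
  then have "homotopic_with_canon ?Q (h ` U) (h ` U) id (h \<circ> \<rho> \<circ> g)"
  proof (rule homotopic_with_eq)
    show "?Q f \<longleftrightarrow> ?Q f'" if eq: "\<And>y. y \<in> topspace (top_of_set (h ` U)) \<Longrightarrow> f y = f' y" for f f'
    proof -
      have "act \<pi> y \<in> h ` U" if \<pi>: "\<pi> \<in> G" and y: "y \<in> h ` U" for \<pi> y
        using y by (auto simp: equi[OF \<pi>, symmetric] intro: U_inv[OF \<pi>])
      then show ?thesis
        using eq ret(1) by (simp add: image_subset_iff subset_iff cong: ball_cong)
    qed
  qed (use gh in auto)
  moreover have "retraction (h ` U) (h ` B) (h \<circ> \<rho> \<circ> g)"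
    unfolding retraction_def
  proof (intro conjI ballI)
    show "continuous_on (h ` U) (h \<circ> \<rho> \<circ> g)"
      using cont_g cont_h ret(1,2,3) g_into
      by (intro continuous_on_compose) (auto simp: image_image elim!: continuous_on_subset)
    show "h \<circ> \<rho> \<circ> g \<in> h ` U \<rightarrow> h ` B"
      using gh ret(3) by auto
    show "(h \<circ> \<rho> \<circ> g) y = y" if "y \<in> h ` B" for y
      using that gh ret(1,4) by auto
  qed (use ret(1) in blast)
  ultimately show ?thesis
    unfolding equivariant_deformation_retraction_def by blast
qed

text \<open>A simplex with a vertex in \<open>A\<close> has that vertex as a face, and the vertex is
  a point of the forbidden set. Conversely, a nonempty support cannot be both inside
  \<open>A\<close> and disjoint from it.\<close>

lemma largest_subcomplex_avoiding_full:
  assumes "abstract_complex L"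
  shows "largest_subcomplex_avoiding L (realization {C \<in> L. C \<subseteq> A}) = {C \<in> L. C \<inter> A = {}}"
  unfolding largest_subcomplex_avoiding_eq
proof (intro equalityI subsetI)
  fix C assume "C \<in> \<Union>{L'. subcomplex L' L \<and> realization L' \<inter> realization {C \<in> L. C \<subseteq> A} = {}}"
  then obtain L' where L': "abstract_complex L'" "L' \<subseteq> L" "C \<in> L'"
    and disj: "realization L' \<inter> realization {C \<in> L. C \<subseteq> A} = {}"
    by (auto simp: subcomplex_def)
  have "v \<notin> A" if "v \<in> C" for v
  proof
    assume "v \<in> A"
    have v: "{v} \<in> L'"
      using abstract_complexD(3)[OF L'(1,3)] that by blast
    have "barycenter {v} \<in> realization L'" "barycenter {v} \<in> realization {C \<in> L. C \<subseteq> A}"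
      using v L'(2) \<open>v \<in> A\<close> by (auto intro: barycenter_in_realization)
    then show False
      using disj by blast
  qed
  then show "C \<in> {C \<in> L. C \<inter> A = {}}"
    using L'(2,3) by blast
next
  fix C assume C: "C \<in> {C \<in> L. C \<inter> A = {}}"
  have "abstract_complex {C \<in> L. C \<inter> A = {}}"
    unfolding abstract_complex_def using abstract_complexD[OF assms] by blast
  moreover have "realization {C \<in> L. C \<inter> A = {}} \<inter> realization {C \<in> L. C \<subseteq> A} = {}"
  proof -
    have "C \<noteq> {}" if "C \<in> L" for C
      using abstract_complexD(2)[OF assms that] .
    then show ?thesis
      unfolding realization_def by blast
  qed
  ultimately show "C \<in> \<Union>{L'. subcomplex L' L \<and> realization L' \<inter> realization {C \<in> L. C \<subseteq> A} = {}}"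
    using C by (intro UnionI[of "{C \<in> L. C \<inter> A = {}}"]) (auto simp: subcomplex_def)
qed

text \<open>
  The homotopy scales the coordinates at \<open>A\<close> linearly down to \<open>0\<close>; the remaining ones have
  positive sum on the complement and are renormalised.
\<close>

lemma equivariant_deformation_retraction_complement_full:
  fixes L :: "'v set set" and q :: "'g \<Rightarrow> 'v \<Rightarrow> 'v"
  assumes L: "abstract_complex L" "finite L"
    and q: "\<And>\<pi>. \<pi> \<in> G \<Longrightarrow> bij (q \<pi>)" "\<And>\<pi> v. \<pi> \<in> G \<Longrightarrow> q \<pi> v \<in> A \<longleftrightarrow> v \<in> A"
  shows "\<exists>\<rho>. equivariant_deformation_retraction G (\<lambda>\<pi> f. f \<circ> q \<pi>)
    (realization L - realization {C \<in> L. C \<subseteq> A}) (realization {C \<in> L. C \<inter> A = {}}) \<rho>"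
proof -
  define U where "U = realization L - realization {C \<in> L. C \<subseteq> A}"
  define B where "B = realization {C \<in> L. C \<inter> A = {}}"
  define M where "M f = (\<Sum>v | f v \<noteq> 0 \<and> v \<notin> A. f v)" for f :: "'v \<Rightarrow> real"
  \<comment> \<open>The straight segment from \<open>f\<close> to its normalised restriction off
    \<open>A\<close>; it preserves mass 1 and stays in the closed simplex spanned by the support of
    \<open>f\<close>.\<close>
  define H where "H z v = (1 - fst z) * snd z v + fst z * (if v \<in> A then 0 else snd z v / M (snd z))"
    for z :: "real \<times> ('v \<Rightarrow> real)" and v
  have finV: "finite (\<Union>L)"
    by (rule finite_vertices[OF L])
  have U: "\<And>v. 0 \<le> f v" "{v. f v \<noteq> 0} \<in> L" "(\<Sum>v | f v \<noteq> 0. f v) = 1" "\<exists>v. f v \<noteq> 0 \<and> v \<notin> A"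
    if "f \<in> U" for f
    using that unfolding U_def realization_def by blast+
  have fin: "finite {v. f v \<noteq> 0}" if "f \<in> U" for f
    using abstract_complexD(1)[OF L(1) U(2)[OF that]] .
  have M_pos: "M f > 0" if "f \<in> U" for f
  proof -
    obtain v where "f v \<noteq> 0" "v \<notin> A"
      using U(4)[OF \<open>f \<in> U\<close>] by blast
    then show ?thesis
      unfolding M_def using fin[OF that] U(1)[OF that]
      by (intro sum_pos2[of _ v]) (simp_all add: less_le)
  qed
  \<comment> \<open>The index set no longer depends on \<open>f\<close>, which makes continuity of
    \<open>M\<close> evident.\<close>
  have M_eq: "M f = sum f (\<Union>L - A)" if "f \<in> U" for f
    unfolding M_def
    by (rule sum.mono_neutral_left) (use finV U(2)[OF that] in auto)
  have H_in: "H (t, f) \<in> U" if t: "0 \<le> t" "t \<le> 1" and f: "f \<in> U" for t f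
  proof -
    let ?S = "{v. f v \<noteq> 0}"
    have nonneg: "0 \<le> H (t, f) v" for v
      using t U(1)[OF f, of v] M_pos[OF f] by (simp add: H_def)
    have zero: "H (t, f) v = 0" if "v \<notin> ?S" for v
      using that by (simp add: H_def)
    have "(\<Sum>v\<in>?S. if v \<in> A then 0 else f v / M f) = (\<Sum>v | f v \<noteq> 0 \<and> v \<notin> A. f v / M f)"
      by (rule sum.mono_neutral_cong_right) (use fin[OF f] in auto)
    also have "\<dots> = 1"
      using M_pos[OF f] by (simp add: M_def flip: sum_divide_distrib)
    finally have *: "(\<Sum>v\<in>?S. if v \<in> A then 0 else f v / M f) = 1" .
    have "sum (H (t, f)) ?S = (1 - t) * sum f ?S + t * (\<Sum>v\<in>?S. if v \<in> A then 0 else f v / M f)"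
      unfolding H_def fst_conv snd_conv by (simp only: sum.distrib sum_distrib_left)
    then have "sum (H (t, f)) ?S = 1"
      using U(3)[OF f] * by simp
    then have "H (t, f) \<in> realization L"
      unfolding realization_iff[OF L(1)] using nonneg zero U(2)[OF f] by blast
    moreover obtain v where v: "f v \<noteq> 0" "v \<notin> A"
      using U(4)[OF f] by blast
    have "f v > 0"
      using v U(1)[OF f, of v] by simp
    have "H (t, f) v > 0"
    proof (cases "t = 0")
      case False
      then have "t * (f v / M f) > 0"
        using t M_pos[OF f] \<open>f v > 0\<close> by simp
      moreover have "(1 - t) * f v \<ge> 0"
        using t \<open>f v > 0\<close> by simp
      ultimately show ?thesis
        using v by (simp add: H_def)
    qed (use v \<open>f v > 0\<close> in \<open>simp add: H_def\<close>)
    then have "H (t, f) \<notin> realization {C \<in> L. C \<subseteq> A}"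
      using v(2) unfolding realization_def by force
    ultimately show ?thesis
      by (simp add: U_def)
  qed
  have H1: "H (1, f) \<in> B" if "f \<in> U" for f
  proof -
    have "H (1, f) \<in> realization L"
      using H_in[of 1 f] that by (simp add: U_def)
    moreover have "{v. H (1, f) v \<noteq> 0} \<inter> A = {}"
      by (auto simp: H_def)
    ultimately show ?thesis
      unfolding B_def realization_def by blast
  qed
  have BU: "B \<subseteq> U"
    using abstract_complexD(2)[OF L(1)] unfolding B_def U_def realization_def by blast
  have H_fix: "H (t, f) = f" if "f \<in> B" for t f
  proof -
    have f: "{v. f v \<noteq> 0} \<inter> A = {}" "(\<Sum>v | f v \<noteq> 0. f v) = 1"
      using that by (auto simp: B_def realization_def)
    then have "{v. f v \<noteq> 0 \<and> v \<notin> A} = {v. f v \<noteq> 0}"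
      by blast
    then have "M f = 1"
      using f(2) by (simp add: M_def)
    moreover have "f v = 0" if "v \<in> A" for v
      using that f(1) by blast
    ultimately show ?thesis
      by (auto simp: fun_eq_iff H_def algebra_simps)
  qed
  \<comment> \<open>\<open>q \<pi>\<close> permutes the vertices outside \<open>A\<close>, so it
    leaves the normalising sum \<open>M\<close> unchanged.\<close>
  have H_equiv: "H (t, f \<circ> q \<pi>) = H (t, f) \<circ> q \<pi>" if "\<pi> \<in> G" for t f \<pi>
  proof -
    have "{v. (f \<circ> q \<pi>) v \<noteq> 0 \<and> v \<notin> A} = q \<pi> -` {v. f v \<noteq> 0 \<and> v \<notin> A}"
      using q(2)[OF that] by auto
    moreover have "sum f (q \<pi> ` (q \<pi> -` C)) = sum (f \<circ> q \<pi>) (q \<pi> -` C)" for C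
      by (rule sum.reindex) (rule inj_on_subset[OF bij_is_inj[OF q(1)[OF that]] subset_UNIV])
    ultimately have "M (f \<circ> q \<pi>) = M f"
      unfolding M_def by (simp only: surj_image_vimage_eq[OF bij_is_surj[OF q(1)[OF that]]])
    then show ?thesis
      using q(2)[OF that] by (simp add: fun_eq_iff H_def)
  qed
  have cont: "continuous_on ({0..1} \<times> U) H"
  proof (rule continuous_on_coordinatewise_then_product)
    fix v
    have c: "continuous_on ({0..1} \<times> U) (\<lambda>z :: real \<times> ('v \<Rightarrow> real). snd z u)" for u
      by (rule continuous_on_product_then_coordinatewise[OF continuous_on_snd[OF continuous_on_id]])
    have "continuous_on ({0..1} \<times> U) (\<lambda>z :: real \<times> ('v \<Rightarrow> real). sum (snd z) (\<Union>L - A))"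
      by (intro continuous_on_sum c)
    then have cM: "continuous_on ({0..1} \<times> U) (\<lambda>z :: real \<times> ('v \<Rightarrow> real). M (snd z))"
      by (rule continuous_on_eq) (auto simp: M_eq)
    show "continuous_on ({0..1} \<times> U) (\<lambda>z. H z v)"
    proof (cases "v \<in> A")
      case True
      then show ?thesis
        unfolding H_def by (simp add: continuous_intros c)
    next
      case False
      have "M (snd z) \<noteq> 0" if "z \<in> {0..1} \<times> U" for z
        using M_pos that by fastforce
      then have "continuous_on ({0..1} \<times> U) (\<lambda>z. (1 - fst z) * snd z v + fst z * (snd z v / M (snd z)))"
        by (intro continuous_intros c cM) blast
      then show ?thesis
        using False by (simp add: H_def)
    qed
  qed
  have "homotopic_with_canon (\<lambda>f. (\<forall>x\<in>B. f x = x) \<and> (\<forall>\<pi>\<in>G. \<forall>x\<in>U. f (x \<circ> q \<pi>) = f x \<circ> q \<pi>))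
      U U id (\<lambda>f. H (1, f))"
    unfolding homotopic_with_def
  proof (intro exI[of _ H] conjI allI ballI)
    show "continuous_map (prod_topology (top_of_set {0..1}) (top_of_set U)) (top_of_set U) H"
      using cont H_in by (auto simp: continuous_map_in_subtopology simp flip: subtopology_Times)
  qed (use H_fix H_equiv in \<open>auto simp: H_def\<close>)
  moreover have "retraction U B (\<lambda>f. H (1, f))"
    unfolding retraction_def
  proof (intro conjI ballI)
    show "continuous_on U (\<lambda>f. H (1, f))"
      by (rule continuous_on_compose2[OF cont]) (auto intro!: continuous_intros)
  qed (use BU H1 H_fix in auto)
  ultimately show ?thesis
    unfolding equivariant_deformation_retraction_def U_def B_def by blast
qed

section \<open>From the subdivided power to the configuration space\<close>

theorem lemma5p2:
  fixes X :: "'v set set" and r :: "'v rel" and d :: nat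
  assumes "ordered_complex X r" and "finite X" and "d \<ge> 1"
  shows
    "(\<exists>g. homeomorphism (realization (Sd (power_complex X r)))
        (power_space (realization X) :: ('n::finite \<Rightarrow> 'v \<Rightarrow> real) set) sd_power_map g) \<and>
     sd_power_map ` (realization (Sd (power_complex X r))
          - realization (Sd (diagonal_complex (d + 1) X r)))
        = (config_space d (realization X) :: ('n \<Rightarrow> 'v \<Rightarrow> real) set) \<and>
     (\<exists>\<rho>. equivariant_deformation_retraction {\<pi>. \<pi> permutes (UNIV :: 'n set)} permute_coords
        (config_space d (realization X) :: ('n \<Rightarrow> 'v \<Rightarrow> real) set)
        (sd_power_map ` realization (W_complex d X r)) \<rho>)"
proof -
  define P where "P = (power_complex X r :: ('n \<Rightarrow> 'v) set set)"
  define D where "D = (diagonal_complex (d + 1) X r :: ('n \<Rightarrow> 'v) set set)"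
  interpret ordered_complex_power X r P
    using assms(1) by unfold_locales (simp_all add: P_def)
  let ?h = "sd_power_map :: (('n \<Rightarrow> 'v) set \<Rightarrow> real) \<Rightarrow> 'n \<Rightarrow> 'v \<Rightarrow> real"
  let ?Y = "power_space (realization X) :: ('n \<Rightarrow> 'v \<Rightarrow> real) set"
  let ?G = "{\<pi>. \<pi> permutes (UNIV :: 'n set)}"
  \<comment> \<open>Precomposing a point with \<open>?q \<pi>\<close> gives \<open>w\<close> the
    role that \<open>w \<circ> \<pi>\<close> had, which on coordinates is
    \<open>permute_coords \<pi>\<close>.\<close>
  let ?q = "\<lambda>\<pi> S. (\<lambda>w :: 'n \<Rightarrow> 'v. w \<circ> \<pi>) ` S"
  let ?U = "realization (Sd P) - realization (Sd D)"
  have finP: "finite P"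
    by (rule finite_power_complex[OF assms(2)])
  have DP: "D \<subseteq> P"
    unfolding D_def by (rule diagonal_complex_subset)
  have h_eq: "?h = power_map \<circ> sd_map"
    by (simp add: fun_eq_iff sd_power_map_def)
  have bij: "bij_betw ?h (realization (Sd P)) ?Y"
    unfolding h_eq by (rule bij_betw_trans[OF bij_betw_sd_map[OF abstract_complex_power] bij_betw_power_map])
  have "sd_map ` realization (Sd P) = realization P"
    using bij_betw_sd_map[OF abstract_complex_power] by (simp add: bij_betw_def)
  then have "continuous_on (realization (Sd P)) ?h"
    unfolding h_eq
    by (intro continuous_on_compose continuous_on_sd_map finP) (simp add: continuous_on_power_map assms(2))
  then obtain g where hom: "homeomorphism (realization (Sd P)) ?Y ?h g"
    using homeomorphism_compact_fun[OF compact_realization[OF abstract_complex_Sd finite_Sd[OF finP]] _ bij]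
    by blast
  have diag: "f \<in> realization (Sd D) \<longleftrightarrow> ?h f \<in> fat_diagonal (d + 1) (realization X)"
    if f: "f \<in> realization (Sd P)" for f
  proof -
    have "chain_weight f" "sd_map f \<in> realization P"
      using f realization_Sd_iff[OF abstract_complex_power] by blast+
    then show ?thesis
      unfolding D_def realization_Sd_iff[OF abstract_complex_diagonal] sd_power_map_def
      by (simp add: realization_diagonal_iff)
  qed
  have img: "?h ` ?U = config_space d (realization X)"
  proof -
    have "?h ` ?U = ?h ` realization (Sd P) - fat_diagonal (d + 1) (realization X)"
      using diag by blast
    then show ?thesis
      using bij by (simp add: bij_betw_def config_space_def)
  qed
  \<comment> \<open>\<open>D\<close> now acts as a set of vertices of \<open>Sd P\<close>, and its
    subdivision is the full subcomplex on them.\<close>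
  have SdD: "Sd D = {C \<in> Sd P. C \<subseteq> D}"
    using DP by (auto simp: Sd_def)
  have W: "W_complex d X r = {C \<in> Sd P. C \<inter> D = {}}"
    unfolding W_complex_def P_def[symmetric] D_def[symmetric] SdD
    by (rule largest_subcomplex_avoiding_full[OF abstract_complex_Sd])
  have bij_comp: "bij (\<lambda>w :: 'n \<Rightarrow> 'v. w \<circ> \<pi>)" if "bij \<pi>" for \<pi>
    using that by (intro o_bij[of "\<lambda>w. w \<circ> inv \<pi>"])
      (simp_all add: fun_eq_iff bij_is_inj bij_is_surj surj_f_inv_f)
  have bij_q: "bij (?q \<pi>)" if "bij \<pi>" for \<pi>
    using bij_comp[OF that] by (intro bijI injI surjI[of _ "\<lambda>S. (\<lambda>w. w \<circ> \<pi>) -` S"])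
      (simp_all only: inj_image_eq_iff[OF bij_is_inj] surj_image_vimage_eq[OF bij_is_surj])
  have q_D: "?q \<pi> S \<in> D \<longleftrightarrow> S \<in> D" if \<pi>: "bij \<pi>" for \<pi> S
  proof
    assume "?q \<pi> S \<in> D"
    then have "(\<lambda>w. w \<circ> \<pi>) -` ?q \<pi> S \<in> D"
      unfolding D_def by (rule diagonal_complex_perm[OF \<pi>])
    then show "S \<in> D"
      by (simp only: inj_vimage_image_eq[OF bij_is_inj[OF bij_comp[OF \<pi>]]])
  next
    assume "S \<in> D"
    then have "(\<lambda>w. w \<circ> inv \<pi>) -` S \<in> D"
      unfolding D_def by (rule diagonal_complex_perm[OF bij_imp_bij_inv[OF \<pi>]])
    then show "?q \<pi> S \<in> D"
      by (simp add: vimage_perm[OF bij_imp_bij_inv[OF \<pi>]] inv_inv_eq[OF \<pi>])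
  qed
  obtain \<rho> where \<rho>: "equivariant_deformation_retraction ?G (\<lambda>\<pi> f. f \<circ> ?q \<pi>) ?U
      (realization {C \<in> Sd P. C \<inter> D = {}}) \<rho>"
    unfolding SdD
    using equivariant_deformation_retraction_complement_full[OF abstract_complex_Sd finite_Sd[OF finP], of ?G ?q D]
      bij_q q_D permutes_bij by blast
  have "equivariant_deformation_retraction ?G permute_coords (?h ` ?U)
      (?h ` realization {C \<in> Sd P. C \<inter> D = {}}) (?h \<circ> \<rho> \<circ> g)"
  proof (rule equivariant_deformation_retraction_homeomorphic_image[OF hom _ \<rho>])
    fix \<pi> and f :: "('n \<Rightarrow> 'v) set \<Rightarrow> real" assume "\<pi> \<in> ?G"
    then have \<pi>: "bij \<pi>"
      by (simp add: permutes_bij)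
    have equi: "?h (f \<circ> ?q \<pi>) = permute_coords \<pi> (?h f)"
      by (simp add: sd_power_map_def permute_coords_def sd_map_comp_bij[OF bij_comp[OF \<pi>]]
          power_map_comp_perm[OF \<pi>])
    then show "?h (f \<circ> ?q \<pi>) = permute_coords \<pi> (?h f)" .
    show "f \<circ> ?q \<pi> \<in> ?U" if f: "f \<in> ?U"
    proof -
      have P: "f \<circ> ?q \<pi> \<in> realization (Sd P)"
        by (rule realization_comp_bij[OF _ bij_q[OF \<pi>] Sd_vimage[OF bij_comp[OF \<pi>] power_complex_perm[OF \<pi>]]])
          (use f in auto)
      have "\<exists>C. f C \<noteq> 0 \<and> C \<notin> D"
        using f unfolding SdD realization_def by blast
      then obtain C where "f C \<noteq> 0" "C \<notin> D"
        by blast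
      moreover obtain S where "C = ?q \<pi> S"
        using bij_is_surj[OF bij_q[OF \<pi>]] by blast
      ultimately have "(f \<circ> ?q \<pi>) S \<noteq> 0" "S \<notin> D"
        using q_D[OF \<pi>] by auto
      then have "f \<circ> ?q \<pi> \<notin> realization (Sd D)"
        unfolding SdD realization_def by blast
      with P show ?thesis
        by blast
    qed
  qed blast
  then show ?thesis
    using hom img unfolding W P_def[symmetric] D_def[symmetric] by auto
qed

end
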